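(* Let $X$ be a Banach function space on $[0,1]$ that is either order continuous or monotonically complete. Then $X$ has $w$-$oBSP$ if and only if it has $w$-$hoBSP$; likewise, $X$ has $X'$-$oBSP$ if and only if it has $X'$-$hoBSP$.
   Context: $L^0$ is the vector lattice of real measurable functions on $[0,1]$ (Lebesgue measure), modulo a.e. equality; inequalities are a.e. A Banach function space $X$ on $[0,1]$ is a Banach space that is a linear subspace of $L^0$ such that $f\in X$ and $\|f\|_X\le\|g\|_X$ whenever $f \in L^0$, $g\in X$ and $|f|\le|g|$. $X_+=\{f\in X: f\ge 0\}$. The associate space $X'$ is the space of all $g\in L^0$ with $\int_0^1|fg|\,dt<\infty$ for all $f\in X$. A sequence $\{f_n\}$ in $X$ is $\sigma(X,X')$-null if $\int_0^1 f_ng\,dt\to0$ for every $g\in X'$. A sequence $\{f_n\}$ in $X$ order converges to $f\in X$ if there is a sequence $\{g_n\}$ in $X$ with $g_n\downarrow0$ and $|f_n-f|\le g_n$ for all $n$; equivalently, $f_n\to f$ a.e. and there is $h\in X_+$ with $|f_n|\le h$ for all $n$. The Cesàro sequence of $\{f_n\}$ is $\{\frac1m\sum_{n=1}^m f_n\}_m$. $X$ is order continuous if $\|f_n\|_X\to0$ whenever $\{f_n\}$ order converges to $0$ in $X$. $X$ is monotonically complete if the pointwise supremum of any increasing, norm bounded sequence in $X_+$ belongs to $X$. $X$ has $w$-$oBSP$ (resp. $X'$-$oBSP$) if every weakly null (resp. $\sigma(X,X')$-null norm bounded) sequence in $X$ has a subsequence whose Cesàro sequence order converges in $X$. $X$ has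 $w$-$hoBSP$ (resp. $X'$-$hoBSP$) if every weakly null (resp. $\sigma(X,X')$-null norm bounded) sequence in $X$ has a subsequence such that the Cesàro sequences of all its further subsequences order converge in $X$ to the same limit. *)

theory Defs
  imports "HOL-Analysis.Analysis"
begin

text \<open>
  Elements of \<open>L\<^sup>0\<close> are handled through representatives: a class of functions modulo a.e. equality
  is given by any Lebesgue measurable function on \<open>[0,1]\<close>, and (in)equalities are a.e.
  Values outside \<open>[0,1]\<close> are irrelevant.
\<close>

abbreviation I01 :: "real measure" where
  "I01 \<equiv> lebesgue_on {0..1}"

abbreviation L0 :: "(real \<Rightarrow> real) set" where
  "L0 \<equiv> borel_measurable I01"

text \<open>
  Since elements are represented by functions, \<open>definite\<close> says that the null functions are exactly
  those vanishing a.e. By \<open>ideal\<close>, both \<open>X\<close> and the norm \<open>N\<close> are invariant under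
  modification on a null set.
\<close>

locale banach_function_space =
  fixes X :: "(real \<Rightarrow> real) set" and N :: "(real \<Rightarrow> real) \<Rightarrow> real"
  assumes subset_L0: "X \<subseteq> L0"
    and zero_mem: "(\<lambda>t. 0) \<in> X"
    and add_mem: "\<lbrakk>f \<in> X; g \<in> X\<rbrakk> \<Longrightarrow> (\<lambda>t. f t + g t) \<in> X"
    and scale_mem: "f \<in> X \<Longrightarrow> (\<lambda>t. c * f t) \<in> X"
    and nonneg: "f \<in> X \<Longrightarrow> 0 \<le> N f"
    and definite: "f \<in> X \<Longrightarrow> N f = 0 \<longleftrightarrow> (AE t in I01. f t = 0)"
    and homogeneous: "f \<in> X \<Longrightarrow> N (\<lambda>t. c * f t) = \<bar>c\<bar> * N f"
    and triangle: "\<lbrakk>f \<in> X; g \<in> X\<rbrakk> \<Longrightarrow> N (\<lambda>t. f t + g t) \<le> N f + N g"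
    and ideal: "\<lbrakk>f \<in> L0; g \<in> X; AE t in I01. \<bar>f t\<bar> \<le> \<bar>g t\<bar>\<rbrakk> \<Longrightarrow> f \<in> X \<and> N f \<le> N g"
    and complete: "\<lbrakk>\<And>n. u n \<in> X;
        \<forall>e>0. \<exists>K. \<forall>m\<ge>K. \<forall>n\<ge>K. N (\<lambda>t. u m t - u n t) < e\<rbrakk>
      \<Longrightarrow> \<exists>f\<in>X. (\<lambda>n. N (\<lambda>t. u n t - f t)) \<longlonglongrightarrow> 0"

definition positive_part :: "(real \<Rightarrow> real) set \<Rightarrow> (real \<Rightarrow> real) set" where
  "positive_part X = {f \<in> X. AE t in I01. 0 \<le> f t}"

definition associate_space :: "(real \<Rightarrow> real) set \<Rightarrow> (real \<Rightarrow> real) set" where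
  "associate_space X = {g \<in> L0. \<forall>f\<in>X. (\<integral>\<^sup>+t. ennreal \<bar>f t * g t\<bar> \<partial>I01) < \<infinity>}"

definition dual_space ::
    "(real \<Rightarrow> real) set \<Rightarrow> ((real \<Rightarrow> real) \<Rightarrow> real) \<Rightarrow> ((real \<Rightarrow> real) \<Rightarrow> real) set" where
  "dual_space X N = {\<phi>.
     (\<forall>f\<in>X. \<forall>g\<in>X. \<phi> (\<lambda>t. f t + g t) = \<phi> f + \<phi> g) \<and>
     (\<forall>f\<in>X. \<forall>c. \<phi> (\<lambda>t. c * f t) = c * \<phi> f) \<and>
     (\<exists>C. \<forall>f\<in>X. \<bar>\<phi> f\<bar> \<le> C * N f)}"

definition weakly_null ::
    "(real \<Rightarrow> real) set \<Rightarrow> ((real \<Rightarrow> real) \<Rightarrow> real) \<Rightarrow> (nat \<Rightarrow> real \<Rightarrow> real) \<Rightarrow> bool" where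
  "weakly_null X N f \<longleftrightarrow>
     (\<forall>n. f n \<in> X) \<and> (\<forall>\<phi>\<in>dual_space X N. (\<lambda>n. \<phi> (f n)) \<longlonglongrightarrow> 0)"

definition associate_null :: "(real \<Rightarrow> real) set \<Rightarrow> (nat \<Rightarrow> real \<Rightarrow> real) \<Rightarrow> bool" where
  "associate_null X f \<longleftrightarrow>
     (\<forall>n. f n \<in> X) \<and> (\<forall>g\<in>associate_space X. (\<lambda>n. LINT t|I01. f n t * g t) \<longlonglongrightarrow> 0)"

definition norm_bounded :: "((real \<Rightarrow> real) \<Rightarrow> real) \<Rightarrow> (nat \<Rightarrow> real \<Rightarrow> real) \<Rightarrow> bool" where
  "norm_bounded N f \<longleftrightarrow> (\<exists>C. \<forall>n. N (f n) \<le> C)"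

text \<open>\<open>g\<^sub>n \<down> 0\<close>: the sequence decreases and its infimum in the lattice \<open>L\<^sup>0\<close> is \<open>0\<close>.\<close>

definition decreases_to_zero :: "(nat \<Rightarrow> real \<Rightarrow> real) \<Rightarrow> bool" where
  "decreases_to_zero g \<longleftrightarrow>
     (\<forall>n. AE t in I01. g (Suc n) t \<le> g n t) \<and>
     (\<forall>n. AE t in I01. 0 \<le> g n t) \<and>
     (\<forall>h\<in>L0. (\<forall>n. AE t in I01. h t \<le> g n t) \<longrightarrow> (AE t in I01. h t \<le> 0))"

definition order_converges ::
    "(real \<Rightarrow> real) set \<Rightarrow> (nat \<Rightarrow> real \<Rightarrow> real) \<Rightarrow> (real \<Rightarrow> real) \<Rightarrow> bool" where
  "order_converges X f l \<longleftrightarrow>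
     (\<forall>n. f n \<in> X) \<and> l \<in> X \<and>
     (\<exists>g. (\<forall>n. g n \<in> X) \<and> decreases_to_zero g \<and>
          (\<forall>n. AE t in I01. \<bar>f n t - l t\<bar> \<le> g n t))"

text \<open>
  Sequences are indexed from \<open>0\<close>, so the \<open>m\<close>-th term below averages the first \<open>m + 1\<close> functions.
\<close>

definition cesaro :: "(nat \<Rightarrow> real \<Rightarrow> real) \<Rightarrow> nat \<Rightarrow> real \<Rightarrow> real" where
  "cesaro f m = (\<lambda>t. (1 / real (Suc m)) * (\<Sum>n\<le>m. f n t))"

definition order_continuous :: "(real \<Rightarrow> real) set \<Rightarrow> ((real \<Rightarrow> real) \<Rightarrow> real) \<Rightarrow> bool" where
  "order_continuous X N \<longleftrightarrow>
     (\<forall>f. order_converges X f (\<lambda>t. 0) \<longrightarrow> (\<lambda>n. N (f n)) \<longlonglongrightarrow> 0)"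

text \<open>
  The pointwise supremum is taken in the extended reals; that it belongs to \<open>X\<close> includes
  that it is finite a.e.
\<close>

definition monotonically_complete ::
    "(real \<Rightarrow> real) set \<Rightarrow> ((real \<Rightarrow> real) \<Rightarrow> real) \<Rightarrow> bool" where
  "monotonically_complete X N \<longleftrightarrow>
     (\<forall>f. (\<forall>n. f n \<in> positive_part X) \<and> (\<forall>n. AE t in I01. f n t \<le> f (Suc n) t) \<and>
          norm_bounded N f \<longrightarrow>
        (\<exists>s\<in>X. AE t in I01. ereal (s t) = (SUP n. ereal (f n t))))"

definition w_oBSP :: "(real \<Rightarrow> real) set \<Rightarrow> ((real \<Rightarrow> real) \<Rightarrow> real) \<Rightarrow> bool" where
  "w_oBSP X N \<longleftrightarrow>
     (\<forall>f. weakly_null X N f \<longrightarrow>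
        (\<exists>r::nat \<Rightarrow> nat. strict_mono r \<and> (\<exists>l. order_converges X (cesaro (f \<circ> r)) l)))"

definition associate_oBSP :: "(real \<Rightarrow> real) set \<Rightarrow> ((real \<Rightarrow> real) \<Rightarrow> real) \<Rightarrow> bool" where
  "associate_oBSP X N \<longleftrightarrow>
     (\<forall>f. associate_null X f \<and> norm_bounded N f \<longrightarrow>
        (\<exists>r::nat \<Rightarrow> nat. strict_mono r \<and> (\<exists>l. order_converges X (cesaro (f \<circ> r)) l)))"

definition w_hoBSP :: "(real \<Rightarrow> real) set \<Rightarrow> ((real \<Rightarrow> real) \<Rightarrow> real) \<Rightarrow> bool" where
  "w_hoBSP X N \<longleftrightarrow>
     (\<forall>f. weakly_null X N f \<longrightarrow>
        (\<exists>r::nat \<Rightarrow> nat. strict_mono r \<and>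
           (\<exists>l. \<forall>s::nat \<Rightarrow> nat. strict_mono s \<longrightarrow> order_converges X (cesaro (f \<circ> r \<circ> s)) l)))"

definition associate_hoBSP :: "(real \<Rightarrow> real) set \<Rightarrow> ((real \<Rightarrow> real) \<Rightarrow> real) \<Rightarrow> bool" where
  "associate_hoBSP X N \<longleftrightarrow>
     (\<forall>f. associate_null X f \<and> norm_bounded N f \<longrightarrow>
        (\<exists>r::nat \<Rightarrow> nat. strict_mono r \<and>
           (\<exists>l. \<forall>s::nat \<Rightarrow> nat. strict_mono s \<longrightarrow> order_converges X (cesaro (f \<circ> r \<circ> s)) l)))"

end

(*
  The set of all L for which the Cesaro sequence of (f n : n in L) order converges is F_sigma-delta in
  the space of infinite subsets of N: order convergence means a.e. convergence plus order
  boundedness, and order boundedness is a condition on the norms of finite maxima once X is order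
  continuous (they form a Cauchy sequence) or monotonically complete (they are bounded). By the
  Galvin-Prikry theorem some infinite B has either all or none of its infinite subsets in this set;
  "none" is excluded, because every subsequence of f is again a null sequence to which the
  Banach-Saks property applies. The limits for two subsequences of B agree: splice them in blocks
  of rapidly increasing length; the means of the spliced sequence cluster at both limits, yet
  converge.
*)

theory Submission
  imports Defs
begin

section \<open>Completely Ramsey properties of infinite sets of naturals\<close>

text \<open>Homogeneous sets for the members of a countable family do not in general yield one for
  the union. The stronger property of being decided over every finite stem \<open>s\<close>, inside
  every infinite set, does pass to countable unions: longer stems leave room to postpone decisions,
  and fusion combines them. Together with complements this admits every condition built by countable
  quantifiers from statements that read finitely many elements of \<open>L\<close>. This shapes the
  analytic half. Order convergence quantifies over a limit \<open>l\<close>, a dominating function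
  and points \<open>t\<close>, all from uncountable ranges, and each must be eliminated:
  \<open>l\<close> is recovered from a.e. convergence, the points disappear into measures of sets,
  and the dominating function into norms of running maxima. The assumption on \<open>X\<close>
  enters in this last elimination.\<close>

definition decided :: "(nat set \<Rightarrow> bool) \<Rightarrow> nat set \<Rightarrow> nat set \<Rightarrow> bool" where
  "decided R s B \<longleftrightarrow> (\<exists>c. \<forall>L\<subseteq>B. infinite L \<longrightarrow> R (s \<union> L) = c)"

text \<open>
  In the usual definition \<open>s\<close> is an initial segment of \<open>s \<union> L\<close>; since \<open>A\<close> may be shrunk to its part
  beyond \<open>s\<close>, omitting this condition does not change the notion.
\<close>

definition completely_ramsey :: "(nat set \<Rightarrow> bool) \<Rightarrow> bool" where
  "completely_ramsey R \<longleftrightarrow>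
     (\<forall>s A. finite s \<longrightarrow> infinite A \<longrightarrow> (\<exists>B\<subseteq>A. infinite B \<and> decided R s B))"

section \<open>Fusion of infinite sets of naturals\<close>

definition beyond :: "nat set \<Rightarrow> nat set \<Rightarrow> nat set" where
  "beyond t B = {b \<in> B. \<forall>x\<in>t. x < b}"

lemma beyond_subset: "beyond t B \<subseteq> B"
  by (auto simp: beyond_def)

lemma beyond_mono: "B \<subseteq> C \<Longrightarrow> beyond t B \<subseteq> beyond t C"
  by (auto simp: beyond_def)

lemma infinite_beyond:
  assumes "finite t" "infinite B"
  shows "infinite (beyond t B)"
proof
  assume fin: "finite (beyond t B)"
  obtain m where m: "\<forall>x\<in>t. x < m"
    using assms(1) by (meson finite_nat_set_iff_bounded)
  have "B \<subseteq> beyond t B \<union> {..m}"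
    using m by (force simp: beyond_def)
  then show False
    using fin assms(2) by (meson finite_UnI finite_atMost finite_subset)
qed

lemma infinite_ex_min:
  fixes M :: "nat set"
  assumes "infinite M"
  shows "\<exists>n\<in>M. \<forall>x\<in>M. n \<le> x"
proof -
  obtain z where "z \<in> M" using infinite_imp_nonempty[OF assms] by blast
  then have "(LEAST x. x \<in> M) \<in> M" by (rule LeastI)
  moreover have "\<forall>x\<in>M. (LEAST x. x \<in> M) \<le> x"
    by (simp add: Least_le)
  ultimately show ?thesis by blast
qed

lemma decided_antimono: "decided R s B \<Longrightarrow> C \<subseteq> B \<Longrightarrow> decided R s C"
  unfolding decided_def by (meson subset_trans)

lemma simultaneous_refinement:
  assumes "finite T" "infinite B" "B \<subseteq> A"
    and hered: "\<And>t B C. Q t B \<Longrightarrow> C \<subseteq> B \<Longrightarrow> infinite C \<Longrightarrow> Q t C"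
    and dense: "\<And>t B. t \<in> T \<Longrightarrow> B \<subseteq> A \<Longrightarrow> infinite B \<Longrightarrow> \<exists>C\<subseteq>B. infinite C \<and> Q t C"
  shows "\<exists>C\<subseteq>B. infinite C \<and> (\<forall>t\<in>T. Q t C)"
  using assms(1,5)
proof (induction T rule: finite_induct)
  case empty
  then show ?case using assms(2) by blast
next
  case (insert t T)
  then obtain C where C: "C \<subseteq> B" "infinite C" "\<forall>u\<in>T. Q u C"
    by blast
  then obtain D where "D \<subseteq> C" "infinite D" "Q t D"
    using insert.prems[of t C] assms(3) by blast
  then show ?case
    using C hered by (metis insert_iff subset_trans)
qed

text \<open>Only finitely many \<open>t\<close> can be served at a time. So the elements of the
  final set are chosen one by one, and after each choice the reservoir of future elements is shrunk
  until \<open>Q t\<close> holds on it for all sets \<open>t\<close> of chosen elements. Heredity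
  preserves what has been achieved.\<close>

lemma fusion:
  assumes "infinite A"
    and hered: "\<And>t B C. Q t B \<Longrightarrow> C \<subseteq> B \<Longrightarrow> infinite C \<Longrightarrow> Q t C"
    and dense: "\<And>t B. finite t \<Longrightarrow> t \<subseteq> A \<Longrightarrow> B \<subseteq> A \<Longrightarrow> infinite B
      \<Longrightarrow> \<exists>C\<subseteq>B. infinite C \<and> Q t C"
  shows "\<exists>B\<subseteq>A. infinite B \<and> (\<forall>t\<subseteq>B. finite t \<longrightarrow> Q t (beyond t B))"
proof -
  define P where "P = (\<lambda>n::nat. \<lambda>(F, B). (n = 0 \<longrightarrow> F = {}) \<and> finite F \<and> F \<subseteq> A \<and> B \<subseteq> A \<and> infinite B \<and>
    (\<forall>x\<in>F. \<forall>b\<in>B. x < b) \<and> (\<forall>t\<subseteq>F. Q t B))"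
  define S where "S = (\<lambda>(F, B) (F', B'). \<exists>b::nat\<in>B. F' = insert b F \<and> B' \<subseteq> (B::nat set))"
  have "\<exists>g. \<forall>n. P n (g n) \<and> S (g n) (g (Suc n))"
  proof (rule dependent_nat_choice)
    obtain B where "B \<subseteq> A" "infinite B" "Q {} B"
      using dense[of "{}" A] assms(1) by auto
    then have "P 0 ({}, B)" by (simp add: P_def)
    then show "\<exists>x. P 0 x" by blast
  next
    fix x :: "nat set \<times> nat set" and n :: nat
    assume "P n x"
    obtain F B where x: "x = (F, B)" by fastforce
    with \<open>P n x\<close> have F: "finite F" "F \<subseteq> A" "B \<subseteq> A" "infinite B" "\<forall>x\<in>F. \<forall>b\<in>B. x < b"
      by (auto simp: P_def)
    then obtain b where b: "b \<in> B"
      by fastforce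
    have "\<exists>C \<subseteq> beyond {b} B. infinite C \<and> (\<forall>t \<in> Pow (insert b F). Q t C)"
    proof (rule simultaneous_refinement[where A = A])
      show "infinite (beyond {b} B)" using F by (simp add: infinite_beyond)
      show "beyond {b} B \<subseteq> A" using F beyond_subset by blast
      show "finite (Pow (insert b F))" using F by simp
      show "\<And>t C. t \<in> Pow (insert b F) \<Longrightarrow> C \<subseteq> A \<Longrightarrow> infinite C \<Longrightarrow> \<exists>D\<subseteq>C. infinite D \<and> Q t D"
        using F b dense by (metis PowD finite_insert finite_subset insert_subset subset_trans subsetD)
    qed (fact hered)
    then obtain C where C: "C \<subseteq> beyond {b} B" "infinite C" "\<forall>t \<in> Pow (insert b F). Q t C"
      by blast
    then have "P (Suc n) (insert b F, C)" "S x (insert b F, C)"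
      using F b by (auto simp: P_def S_def x beyond_def)
    then show "\<exists>y. P (Suc n) y \<and> S x y" by blast
  qed
  then obtain g where g: "\<And>n. P n (g n)" "\<And>n. S (g n) (g (Suc n))" by blast
  define F where "F n = fst (g n)" for n
  define B where "B n = snd (g n)" for n
  have F: "finite (F n)" "F n \<subseteq> A" "infinite (B n)" "x \<in> F n \<Longrightarrow> b \<in> B n \<Longrightarrow> x < b"
      "t \<subseteq> F n \<Longrightarrow> Q t (B n)" for n x b t
    using g(1)[of n] by (auto simp: P_def F_def B_def case_prod_beta)
  have step: "\<exists>b\<in>B n. F (Suc n) = insert b (F n)" and B_Suc: "B (Suc n) \<subseteq> B n" for n
    using g(2)[of n] by (auto simp: S_def F_def B_def case_prod_beta)
  have F_mono: "m \<le> n \<Longrightarrow> F m \<subseteq> F n" for m n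
    by (rule lift_Suc_mono_le[of F]) (use step in blast)
  have B_anti: "m \<le> n \<Longrightarrow> B n \<subseteq> B m" for m n
    by (rule lift_Suc_antimono_le[of B]) (use B_Suc in blast)
  have split: "F m \<subseteq> F n \<union> B n" for m n
  proof (induction m)
    case (Suc m)
    obtain b where b: "b \<in> B m" "F (Suc m) = insert b (F m)"
      using step by blast
    show ?case
    proof (cases "Suc m \<le> n")
      case True
      then show ?thesis using F_mono by blast
    next
      case False
      then show ?thesis using b Suc B_anti[of n m] by auto
    qed
  qed (use F_mono[of 0 n] in auto)
  have card_F: "n \<le> card (F n)" for n
  proof (induction n)
    case (Suc n)
    obtain b where "b \<in> B n" "F (Suc n) = insert b (F n)"
      using step by blast
    moreover have "b \<notin> F n"
      using F(4) \<open>b \<in> B n\<close> by blast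
    ultimately show ?case using Suc F(1) by simp
  qed simp
  define D where "D = (\<Union>n. F n)"
  have "infinite D"
  proof
    assume "finite D"
    have "card (F n) \<le> card D" for n
      using \<open>finite D\<close> by (intro card_mono) (auto simp: D_def)
    then show False
      using card_F[of "Suc (card D)"] by (metis le_trans not_less_eq_eq order_refl)
  qed
  moreover have "Q t (beyond t D)" if t: "t \<subseteq> D" "finite t" for t
  proof -
    have "\<exists>n. t \<subseteq> F n"
      using t(2,1)
    proof (induction t rule: finite_induct)
      case (insert x t)
      then obtain m n where "t \<subseteq> F m" "x \<in> F n"
        by (auto simp: D_def)
      then have "insert x t \<subseteq> F (max m n)"
        using F_mono[of m "max m n"] F_mono[of n "max m n"] by auto
      then show ?case by blast
    qed simp
    \<comment> \<open>Minimality matters: if the stage is not \<open>0\<close>, the element added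
      last lies in \<open>t\<close> and exceeds all earlier ones. Hence \<open>beyond t D\<close>
      has only elements chosen later, which come from the reservoir of this stage.\<close>
    then have n: "t \<subseteq> F (LEAST n. t \<subseteq> F n)" (is "t \<subseteq> F ?n") by (rule LeastI_ex)
    have "beyond t D \<subseteq> B ?n"
    proof (cases ?n)
      case 0
      have "F 0 = {}"
        using g(1)[of 0] by (auto simp: P_def F_def case_prod_beta)
      then show ?thesis using split[of _ 0] unfolding 0 by (fastforce simp: D_def beyond_def)
    next
      case (Suc k)
      obtain b where b: "b \<in> B k" "F (Suc k) = insert b (F k)"
        using step by blast
      have "\<not> t \<subseteq> F k"
        using not_less_Least[of k "\<lambda>n. t \<subseteq> F n"] Suc by simp
      then have "b \<in> t"
        using n b Suc by auto
      then have "x \<notin> F (Suc k)" if "x \<in> beyond t D" for x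
        using that b F(4)[of x k b] by (auto simp: beyond_def)
      then show ?thesis
        using split[of _ "Suc k"] Suc by (fastforce simp: D_def beyond_def)
    qed
    moreover have "infinite (beyond t D)"
      using t \<open>infinite D\<close> by (simp add: infinite_beyond)
    ultimately show ?thesis
      using F(5)[OF n] hered by blast
  qed
  moreover have "D \<subseteq> A" using F(2) by (auto simp: D_def)
  ultimately show ?thesis by blast
qed

text \<open>The Galvin-Prikry argument with accepted and rejected stems, for sets open in the
  Ellentuck topology. Openness is asked only inside \<open>A\<close>, because a countable union
  becomes open only after passing to a smaller set.\<close>

lemma ellentuck_open_ramsey:
  assumes "infinite A"
    and op: "\<And>L. L \<subseteq> A \<Longrightarrow> infinite L \<Longrightarrow> R L
      \<Longrightarrow> \<exists>t\<subseteq>L. finite t \<and> (\<forall>M\<subseteq>beyond t L. infinite M \<longrightarrow> R (t \<union> M))"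
  shows "\<exists>B\<subseteq>A. infinite B \<and> decided R {} B"
proof -
  \<comment> \<open>Both notions pass to smaller sets, and an infinite set that does not reject
    \<open>t\<close> contains an infinite one that accepts it. These are the two requirements of
    \<open>fusion\<close>.\<close>
  define acc where "acc t B \<longleftrightarrow> (\<forall>M\<subseteq>beyond t B. infinite M \<longrightarrow> R (t \<union> M))" for t B
  define rej where "rej t B \<longleftrightarrow> (\<forall>C\<subseteq>B. infinite C \<longrightarrow> \<not> acc t C)" for t B
  have beyond_idem: "beyond t (beyond t B) = beyond t B" for t B
    by (auto simp: beyond_def)
  have acc_beyond: "acc t (beyond t B) \<longleftrightarrow> acc t B" for t B
    by (simp add: acc_def beyond_idem)
  have acc_anti: "acc t B \<Longrightarrow> C \<subseteq> B \<Longrightarrow> acc t C" for t B C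
    unfolding acc_def by (meson beyond_mono subset_trans)
  have rej_anti: "rej t B \<Longrightarrow> C \<subseteq> B \<Longrightarrow> rej t C" for t B C
    unfolding rej_def by (meson subset_trans)
  have "\<exists>B\<subseteq>A. infinite B \<and>
    (\<forall>t\<subseteq>B. finite t \<longrightarrow> acc t (beyond t B) \<or> rej t (beyond t B))"
  proof (rule fusion)
    fix t B :: "nat set" assume "finite t" "infinite B"
    then show "\<exists>C\<subseteq>B. infinite C \<and> (acc t C \<or> rej t C)"
      by (cases "rej t B") (auto simp: rej_def)
  qed (use assms(1) acc_anti rej_anti in blast)+
  then obtain B where B: "B \<subseteq> A" "infinite B"
      "\<And>t. t \<subseteq> B \<Longrightarrow> finite t \<Longrightarrow> acc t (beyond t B) \<or> rej t (beyond t B)"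
    by blast
  have dec: "acc t B \<or> rej t B" if t: "t \<subseteq> B" "finite t" for t
  proof (rule disjCI)
    assume "\<not> rej t B"
    then obtain C where C: "C \<subseteq> B" "infinite C" "acc t C"
      by (auto simp: rej_def)
    then have "\<not> rej t (beyond t B)"
      using infinite_beyond[OF t(2)] beyond_mono acc_beyond unfolding rej_def by metis
    then show "acc t B"
      using B(3) t acc_beyond by blast
  qed
  show ?thesis
  proof (cases "acc {} B")
    case True
    then have "decided R {} B"
      by (auto simp: acc_def decided_def beyond_def)
    then show ?thesis using B by blast
  next
    case False
    then have rej_empty: "rej {} B" using dec by blast
    \<comment> \<open>A second fusion makes rejection spread from a stem to its one-element end
      extensions; from the empty stem it then reaches every finite subset of the resulting
      set.\<close>
    define Q where "Q t C \<longleftrightarrow> (rej t B \<longrightarrow> (\<forall>n\<in>C. (\<forall>x\<in>t. x < n) \<longrightarrow> rej (insert n t) B))" for t C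
    have "\<exists>C\<subseteq>B. infinite C \<and> (\<forall>t\<subseteq>C. finite t \<longrightarrow> Q t (beyond t C))"
    proof (rule fusion)
      fix t C assume t: "finite t" "t \<subseteq> B" "C \<subseteq> B" "infinite C"
      show "\<exists>D\<subseteq>C. infinite D \<and> Q t D"
      proof (cases "rej t B")
        case True
        define D where "D = {n \<in> beyond t C. \<not> rej (insert n t) B}"
        have D: "acc (insert n t) B" if "n \<in> D" for n
          using that dec[of "insert n t"] t by (auto simp: D_def beyond_def)
        have "finite D"
        proof (rule ccontr)
          assume "infinite D"
          have "acc t D"
            unfolding acc_def
          proof (intro allI impI)
            fix M assume M: "M \<subseteq> beyond t D" "infinite M"
            obtain n where n: "n \<in> M" "\<forall>x\<in>M. n \<le> x"
              using infinite_ex_min[OF M(2)] by blast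
            have "M - {n} \<subseteq> beyond (insert n t) B"
            proof
              fix x assume x: "x \<in> M - {n}"
              then have "n < x" using n(2)[rule_format, of x] by fastforce
              then show "x \<in> beyond (insert n t) B"
                using x M(1) t(3) by (auto simp: D_def beyond_def)
            qed
            moreover have "infinite (M - {n})" using M(2) by simp
            ultimately have "R (insert n t \<union> (M - {n}))"
              using D[unfolded acc_def] n(1) M(1) beyond_subset by blast
            moreover have "insert n t \<union> (M - {n}) = t \<union> M" using n(1) by blast
            ultimately show "R (t \<union> M)" by simp
          qed
          moreover have "D \<subseteq> B" using t by (auto simp: D_def beyond_def)
          ultimately show False using True \<open>infinite D\<close> by (auto simp: rej_def)
        qed
        then have "infinite (C - D)" using t by simp
        then show ?thesis
          by (intro exI[of _ "C - D"]) (auto simp: D_def Q_def beyond_def)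
      qed (use t in \<open>auto simp: Q_def\<close>)
    qed (use B in \<open>auto simp: Q_def\<close>)
    then obtain C where C: "C \<subseteq> B" "infinite C" and
      C_rej: "\<forall>t\<subseteq>C. finite t \<longrightarrow> Q t (beyond t C)"
      by (elim exE conjE) (rule that)
    have C_step: "rej (insert n t) B"
      if "t \<subseteq> C" "finite t" "rej t B" "n \<in> C" "\<forall>x\<in>t. x < n" for t n
    proof -
      have "n \<in> beyond t C" using that by (simp add: beyond_def)
      then show ?thesis using C_rej[rule_format, of t] that by (simp add: Q_def)
    qed
    have rej_all: "t \<subseteq> C \<Longrightarrow> rej t B" if "finite t" for t
      using that
    proof (induction t rule: finite_linorder_max_induct)
      case empty
      show ?case by (fact rej_empty)
    next
      case (insert n t)
      then have "t \<subseteq> C" "n \<in> C" by blast+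
      with insert show ?case by (intro C_step) blast+
    qed
    \<comment> \<open>By openness, a set satisfying \<open>R\<close> would itself accept one of its
      finite subsets, but \<open>B\<close> rejects all finite subsets of \<open>C\<close>.\<close>
    have "\<not> R L" if L: "L \<subseteq> C" "infinite L" for L
    proof
      assume "R L"
      moreover have "L \<subseteq> A" using L B(1) C(1) by blast
      ultimately obtain t where "t \<subseteq> L" "finite t" "acc t L"
        using op[of L] L(2) unfolding acc_def by blast
      then show False
        using rej_all[of t] L C unfolding rej_def by blast
    qed
    then have "decided R {} C" by (auto simp: decided_def)
    then show ?thesis using B C by blast
  qed
qed

text \<open>The hypothesis is openness in the product topology. For each stem \<open>s\<close> it
  gives Ellentuck openness with finite part \<open>L \<inter> {..m}\<close>, since no element beyond
  that part is below \<open>m\<close>.\<close>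

lemma completely_ramsey_open:
  assumes "\<And>L. infinite L \<Longrightarrow> R L \<Longrightarrow>
    \<exists>m. \<forall>L'. infinite L' \<longrightarrow> L' \<inter> {..<m} = L \<inter> {..<m} \<longrightarrow> R L'"
  shows "completely_ramsey R"
  unfolding completely_ramsey_def
proof (intro allI impI)
  fix s A :: "nat set"
  assume A: "finite s" "infinite A"
  have "\<exists>B\<subseteq>A. infinite B \<and> decided (\<lambda>L. R (s \<union> L)) {} B"
  proof (rule ellentuck_open_ramsey)
    fix L assume L: "L \<subseteq> A" "infinite L" "R (s \<union> L)"
    then obtain m where m: "\<And>L'. infinite L' \<Longrightarrow> L' \<inter> {..<m} = (s \<union> L) \<inter> {..<m} \<Longrightarrow> R L'"
      using assms[of "s \<union> L"] by auto
    have "R (s \<union> (L \<inter> {..m} \<union> M))" if M: "M \<subseteq> beyond (L \<inter> {..m}) L" "infinite M" for M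
    proof (rule m)
      show "infinite (s \<union> (L \<inter> {..m} \<union> M))" using M by simp
      have "M \<inter> {..<m} = {}" using M(1) by (fastforce simp: beyond_def)
      then show "(s \<union> (L \<inter> {..m} \<union> M)) \<inter> {..<m} = (s \<union> L) \<inter> {..<m}" by auto
    qed
    then show "\<exists>t\<subseteq>L. finite t \<and> (\<forall>M\<subseteq>beyond t L. infinite M \<longrightarrow> R (s \<union> (t \<union> M)))"
      by (intro exI[of _ "L \<inter> {..m}"]) auto
  qed (fact A(2))
  then show "\<exists>B\<subseteq>A. infinite B \<and> decided R s B"
    by (simp add: decided_def)
qed

section \<open>Closure under complements and countable quantifiers\<close>

lemma completely_ramsey_not:
  "completely_ramsey R \<Longrightarrow> completely_ramsey (\<lambda>L. \<not> R L)"
  unfolding completely_ramsey_def decided_def by (metis (full_types))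

lemma ex_initial_segment:
  assumes "infinite L"
  shows "\<exists>t\<subseteq>L. finite t \<and> card t = n \<and> L = t \<union> beyond t L"
proof (induction n)
  case 0
  show ?case by (auto simp: beyond_def)
next
  case (Suc n)
  then obtain t where t: "t \<subseteq> L" "finite t" "card t = n" "L = t \<union> beyond t L" by blast
  obtain b where b: "b \<in> beyond t L" "\<forall>x\<in>beyond t L. b \<le> x"
    using infinite_ex_min[OF infinite_beyond[OF t(2) assms]] by (elim bexE) (rule that)
  have "b \<notin> t" using b(1) by (auto simp: beyond_def)
  moreover have "L \<subseteq> insert b t \<union> beyond (insert b t) L"
  proof
    fix x assume "x \<in> L"
    then consider "x \<in> t" | "x \<in> beyond t L" using t(4) by blast
    then show "x \<in> insert b t \<union> beyond (insert b t) L"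
    proof cases
      case 2
      then show ?thesis using b(2)[rule_format, of x] by (auto simp: beyond_def)
    qed simp
  qed
  moreover have "insert b t \<union> beyond (insert b t) L \<subseteq> L"
    using t(1) b(1) beyond_subset by blast
  ultimately have "L = insert b t \<union> beyond (insert b t) L" by blast
  moreover have "insert b t \<subseteq> L" using t(1) b(1) beyond_subset by blast
  moreover have "card (insert b t) = Suc n" using t(2,3) \<open>b \<notin> t\<close> by simp
  ultimately show ?case using t(2) by (intro exI[of _ "insert b t"] conjI) simp_all
qed

text \<open>A fusion step handles finitely many conditions per stem, so \<open>R n\<close> is
  decided only over stems with at least \<open>n\<close> elements. If \<open>L\<close> satisfies
  \<open>R n\<close>, its first \<open>n\<close> elements form such a stem, and all continuations
  inside \<open>L\<close> satisfy \<open>R n\<close> too. Thus the union has become Ellentuck open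
  inside \<open>B\<close>.\<close>

lemma completely_ramsey_ex:
  fixes R :: "nat \<Rightarrow> nat set \<Rightarrow> bool"
  assumes "\<And>n. completely_ramsey (R n)"
  shows "completely_ramsey (\<lambda>L. \<exists>n. R n L)"
  unfolding completely_ramsey_def
proof (intro allI impI)
  fix s A :: "nat set"
  assume A: "finite s" "infinite A"
  have "\<exists>B\<subseteq>A. infinite B \<and>
    (\<forall>t\<subseteq>B. finite t \<longrightarrow> (\<forall>n\<in>{..card t}. decided (R n) (s \<union> t) (beyond t B)))"
  proof (rule fusion)
    fix t B :: "nat set"
    assume "finite t" "infinite B"
    then show "\<exists>C\<subseteq>B. infinite C \<and> (\<forall>n\<in>{..card t}. decided (R n) (s \<union> t) C)"
      using assms A(1) decided_antimono
      by (intro simultaneous_refinement[where A = UNIV]) (auto simp: completely_ramsey_def)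
  qed (use A decided_antimono in blast)+
  then obtain B where B: "B \<subseteq> A" "infinite B"
      "\<And>t n. t \<subseteq> B \<Longrightarrow> finite t \<Longrightarrow> n \<le> card t \<Longrightarrow> decided (R n) (s \<union> t) (beyond t B)"
    by (metis atMost_iff)
  have "\<exists>C\<subseteq>B. infinite C \<and> decided (\<lambda>L. \<exists>n. R n (s \<union> L)) {} C"
  proof (rule ellentuck_open_ramsey)
    fix L assume L: "L \<subseteq> B" "infinite L" "\<exists>n. R n (s \<union> L)"
    then obtain n where n: "R n (s \<union> L)" by blast
    obtain t where t: "t \<subseteq> L" "finite t" "card t = n" "L = t \<union> beyond t L"
      using ex_initial_segment[OF L(2)] by blast
    have sub: "beyond t L \<subseteq> beyond t B" using L by (simp add: beyond_mono)
    obtain c where c: "\<And>M. M \<subseteq> beyond t B \<Longrightarrow> infinite M \<Longrightarrow> R n (s \<union> t \<union> M) = c"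
      using B(3)[of t n] t L by (auto simp: decided_def)
    have "s \<union> t \<union> beyond t L = s \<union> L" using t(4) by blast
    then have c
      using c[OF sub] infinite_beyond[OF t(2) L(2)] n by simp
    then have "R n (s \<union> (t \<union> M))" if "M \<subseteq> beyond t L" "infinite M" for M
      using c[of M] that sub by (simp add: Un_assoc)
    then show "\<exists>t\<subseteq>L. finite t \<and>
        (\<forall>M\<subseteq>beyond t L. infinite M \<longrightarrow> (\<exists>n. R n (s \<union> (t \<union> M))))"
      using t(1,2) by (intro exI[of _ t]) blast
  qed (fact B(2))
  then obtain C where C: "C \<subseteq> B" "infinite C" "decided (\<lambda>L. \<exists>n. R n (s \<union> L)) {} C"
    by (elim exE conjE) (rule that)
  then have "decided (\<lambda>L. \<exists>n. R n L) s C" by (simp add: decided_def)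
  moreover have "C \<subseteq> A" using C(1) B(1) by (rule subset_trans)
  ultimately show "\<exists>B\<subseteq>A. infinite B \<and> decided (\<lambda>L. \<exists>n. R n L) s B"
    using C(2) by (intro exI[of _ C] conjI)
qed

lemma completely_ramsey_all:
  fixes R :: "nat \<Rightarrow> nat set \<Rightarrow> bool"
  assumes "\<And>n. completely_ramsey (R n)"
  shows "completely_ramsey (\<lambda>L. \<forall>n. R n L)"
  using completely_ramsey_not[OF completely_ramsey_ex[of "\<lambda>n L. \<not> R n L"]]
    completely_ramsey_not assms by simp

lemma completely_ramsey_conj:
  assumes "completely_ramsey P" "completely_ramsey Q"
  shows "completely_ramsey (\<lambda>L. P L \<and> Q L)"
proof -
  define R where "R n = (if n = 0 then P else Q)" for n :: nat
  have "completely_ramsey (R n)" for n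
    using assms by (simp add: R_def)
  then have "completely_ramsey (\<lambda>L. \<forall>n. R n L)"
    by (rule completely_ramsey_all)
  moreover have "(\<forall>n. R n L) \<longleftrightarrow> P L \<and> Q L" for L
  proof
    assume "\<forall>n. R n L"
    then have "R 0 L" "R 1 L" by blast+
    then show "P L \<and> Q L" by (simp add: R_def)
  qed (simp add: R_def)
  ultimately show ?thesis by simp
qed

section \<open>Conditions on the first elements of an infinite set\<close>

lemma enumerate_eqI:
  fixes L L' :: "nat set"
  assumes "infinite L" "infinite L'"
    and same: "\<And>x. x \<le> enumerate L m \<Longrightarrow> x \<in> L' \<longleftrightarrow> x \<in> L"
  shows "i \<le> m \<Longrightarrow> enumerate L i = enumerate L' i"
proof (induction i)
  case 0
  have le: "enumerate L 0 \<le> enumerate L m" using assms(1) by simp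
  have "(LEAST x. x \<in> L') = enumerate L 0"
  proof (rule Least_equality)
    show "enumerate L 0 \<in> L'"
      using same[OF le] enumerate_in_set[OF assms(1)] by simp
    fix y assume "y \<in> L'"
    show "enumerate L 0 \<le> y"
    proof (rule ccontr)
      assume less: "\<not> enumerate L 0 \<le> y"
      then have "y \<in> L" using same[of y] le \<open>y \<in> L'\<close> by simp
      then show False using less by (simp add: enumerate_0 Least_le)
    qed
  qed
  then show ?case by (simp add: enumerate_0)
next
  case (Suc i)
  then have IH: "enumerate L i = enumerate L' i" by simp
  have le: "enumerate L (Suc i) \<le> enumerate L m" using assms(1) Suc by simp
  have "(LEAST x. x \<in> L' \<and> enumerate L' i < x) = enumerate L (Suc i)"
  proof (rule Least_equality)
    show "enumerate L (Suc i) \<in> L' \<and> enumerate L' i < enumerate L (Suc i)"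
      using same[OF le] enumerate_in_set[OF assms(1)] assms(1) by (simp flip: IH)
    fix y assume y: "y \<in> L' \<and> enumerate L' i < y"
    show "enumerate L (Suc i) \<le> y"
    proof (rule ccontr)
      assume less: "\<not> enumerate L (Suc i) \<le> y"
      then have "y \<in> L" using same[of y] le y by simp
      then have "enumerate L (Suc i) \<le> y"
        using y assms(1) IH by (auto simp: enumerate_Suc'' intro: Least_le)
      with less show False by simp
    qed
  qed
  then show ?case using assms(2) by (simp add: enumerate_Suc'')
qed

lemma enumerate_range:
  fixes r :: "nat \<Rightarrow> nat"
  assumes "strict_mono r"
  shows "enumerate (range r) = r"
proof
  fix n
  have inf: "infinite (range r)"
    using assms by (simp add: range_inj_infinite strict_mono_imp_inj_on)
  show "enumerate (range r) n = r n"
  proof (induction n)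
    case 0
    show ?case
      unfolding enumerate_0 by (rule Least_equality) (use assms in \<open>auto simp: strict_mono_less_eq\<close>)
  next
    case (Suc n)
    show ?case
      unfolding enumerate_Suc''[OF inf] Suc
      by (rule Least_equality) (use assms in \<open>auto simp: strict_mono_less_eq strict_mono_less\<close>)
  qed
qed

text \<open>Agreement of two sets up to \<open>enumerate L m\<close> fixes their first
  \<open>m + 1\<close> elements, so the condition is open. Such conditions are the atoms from which
  order convergence is later assembled.\<close>

lemma completely_ramsey_finite_dependence:
  assumes dep: "\<And>L L'. infinite L \<Longrightarrow> infinite L' \<Longrightarrow>
    (\<And>i. i \<le> m \<Longrightarrow> enumerate L i = enumerate L' i) \<Longrightarrow> R L \<Longrightarrow> R L'"
  shows "completely_ramsey R"
proof (rule completely_ramsey_open)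
  fix L assume L: "infinite L" "R L"
  have "R L'" if L': "infinite L'" "L' \<inter> {..<Suc (enumerate L m)} = L \<inter> {..<Suc (enumerate L m)}" for L'
  proof (rule dep[OF L(1) L'(1) _ L(2)])
    fix i assume "i \<le> m"
    then show "enumerate L i = enumerate L' i"
      using L' by (intro enumerate_eqI[OF L(1) L'(1)]) (auto simp: set_eq_iff less_Suc_eq_le)
  qed
  then show "\<exists>m. \<forall>L'. infinite L' \<longrightarrow> L' \<inter> {..<m} = L \<inter> {..<m} \<longrightarrow> R L'" by blast
qed

section \<open>Splicing two sequences\<close>

text \<open>Indexed by a cutoff on the elements instead of the number of terms, so that means over
  different index sets can be compared at the same place.\<close>

definition average :: "(nat \<Rightarrow> real) \<Rightarrow> nat set \<Rightarrow> nat \<Rightarrow> real" where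
  "average x S d = (\<Sum>i\<in>S \<inter> {..<d}. x i) / real (card (S \<inter> {..<d}))"

lemma strict_mono_initial_segment:
  fixes r :: "nat \<Rightarrow> nat"
  assumes "strict_mono r"
  shows "range r \<inter> {..<d} = r ` {..<LEAST n. d \<le> r n}"
proof -
  have ex: "d \<le> r d" using assms by (rule strict_mono_imp_increasing)
  have "r n < d \<longleftrightarrow> n < (LEAST n. d \<le> r n)" for n
    by (metis (mono_tags, lifting) LeastI assms ex linorder_not_le not_less_Least order_trans
        strict_mono_less_eq)
  then show ?thesis by auto
qed

lemma card_initial_segment:
  fixes r :: "nat \<Rightarrow> nat"
  assumes "strict_mono r"
  shows "card (range r \<inter> {..<r n}) = n"
proof -
  have "range r \<inter> {..<r n} = r ` {..<n}"
    using assms by (auto simp: strict_mono_less)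
  then show ?thesis
    by (metis assms card_image card_lessThan strict_mono_imp_inj_on strict_mono_on_imp_inj_on
        inj_on_subset subset_UNIV)
qed

lemma average_tendsto:
  fixes r :: "nat \<Rightarrow> nat" and x :: "nat \<Rightarrow> real"
  assumes r: "strict_mono r"
    and lim: "(\<lambda>m. (1 / real (Suc m)) * (\<Sum>n\<le>m. x (r n))) \<longlonglongrightarrow> l"
  shows "average x (range r) \<longlonglongrightarrow> l"
proof -
  \<comment> \<open>This counts the elements of \<open>range r\<close> below \<open>d\<close>. A
    Cesaro mean of index \<open>m\<close> has \<open>m + 1\<close> terms, so the matching index is
    \<open>k d - 1\<close>, correct as soon as \<open>r 0 < d\<close>.\<close>
  define k where "k d = (LEAST n. d \<le> r n)" for d
  have seg: "range r \<inter> {..<d} = r ` {..<k d}" for d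
    unfolding k_def using r by (rule strict_mono_initial_segment)
  have inj: "inj_on r A" for A
    using r by (meson inj_on_subset strict_mono_imp_inj_on subset_UNIV)
  have k_ge: "n < k d" if "r n < d" for n d
  proof -
    have "r n \<in> r ` {..<k d}" using that seg[of d] by blast
    then show ?thesis using inj[of UNIV] by (auto dest: injD)
  qed
  have k_lim: "filterlim (\<lambda>d. k d - 1) at_top at_top"
    unfolding filterlim_at_top eventually_at_top_linorder
  proof
    fix Z
    show "\<exists>N. \<forall>n\<ge>N. Z \<le> k n - 1"
    proof (intro exI allI impI)
      fix n assume "Suc (r Z) \<le> n"
      then show "Z \<le> k n - 1" using k_ge[of Z n] by simp
    qed
  qed
  have "average x (range r) d = (1 / real (Suc (k d - 1))) * (\<Sum>n\<le>k d - 1. x (r n))"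
    if "r 0 < d" for d
  proof -
    have "k d > 0" using k_ge[OF that] by simp
    then have "Suc (k d - 1) = k d" "{..k d - 1} = {..<k d}" by auto
    then show ?thesis
      by (simp add: average_def seg card_image[OF inj] sum.reindex[OF inj] del: of_nat_Suc)
  qed
  then have "eventually (\<lambda>d. (1 / real (Suc (k d - 1))) * (\<Sum>n\<le>k d - 1. x (r n))
      = average x (range r) d) sequentially"
    unfolding eventually_sequentially by (metis Suc_le_eq)
  then show ?thesis
    using filterlim_compose[OF lim k_lim] by (rule Lim_transform_eventually[rotated])
qed

text \<open>Up to \<open>e j\<close> the sums over \<open>P\<close> and \<open>Q\<close> differ only
  in their parts below \<open>d j\<close>. Each such part is a convergent mean times a number of
  terms that is negligible against the count of \<open>Q\<close>, so it vanishes after division even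
  when \<open>x\<close> is unbounded.\<close>

lemma block_limit_unique:
  fixes x :: "nat \<Rightarrow> real"
  assumes block: "\<And>j. P \<inter> {d j..<e j} = Q \<inter> {d j..<e j}" and le: "\<And>j. d j \<le> e j"
    and pos: "\<And>j. 0 < card (Q \<inter> {..<e j})"
    and small: "(\<lambda>j. real (d j) / real (card (Q \<inter> {..<e j}))) \<longlonglongrightarrow> 0"
    and d: "filterlim d at_top sequentially" and e: "filterlim e at_top sequentially"
    and P: "average x P \<longlonglongrightarrow> lP" and Q: "average x Q \<longlonglongrightarrow> lQ"
  shows "lP = lQ"
proof -
  define c where "c j = real (card (Q \<inter> {..<e j}))" for j
  define p where "p j = real (card (P \<inter> {..<d j})) / c j" for j
  define q where "q j = real (card (Q \<inter> {..<d j})) / c j" for j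
  have c: "c j > 0" for j using pos by (simp add: c_def)
  have sub: "card (S \<inter> {..<n}) \<le> n" for S and n :: nat
    by (metis Int_lower2 card_lessThan card_mono finite_lessThan)
  have "(\<lambda>j. real (card (S \<inter> {..<d j})) / c j) \<longlonglongrightarrow> 0" for S
    by (rule tendsto_sandwich[OF _ _ tendsto_const small])
       (use sub c in \<open>auto simp: c_def intro!: always_eventually divide_right_mono\<close>)
  then have p: "p \<longlonglongrightarrow> 0" and q: "q \<longlonglongrightarrow> 0" by (simp_all add: p_def[abs_def] q_def[abs_def])
  have split: "S \<inter> {..<e j} = S \<inter> {..<d j} \<union> S \<inter> {d j..<e j}" for S j
    using le[of j] by auto
  have sum_split: "sum y (S \<inter> {..<e j}) = sum y (S \<inter> {..<d j}) + sum y (S \<inter> {d j..<e j})"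
    for S j and y :: "nat \<Rightarrow> real"
    by (subst split, rule sum.union_disjoint) auto
  have sum_eq: "sum y (P \<inter> {..<e j}) = sum y (P \<inter> {..<d j}) + sum y (Q \<inter> {..<e j})
      - sum y (Q \<inter> {..<d j})" for j and y :: "nat \<Rightarrow> real"
    using sum_split[of y P j] sum_split[of y Q j] block[of j] by simp
  have avg: "sum x (S \<inter> {..<n}) = average x S n * real (card (S \<inter> {..<n}))" for S n
    by (cases "card (S \<inter> {..<n}) = 0") (auto simp: average_def)
  have card_eq: "real (card (P \<inter> {..<e j})) / c j = 1 + p j - q j" for j
  proof -
    have "real (card (P \<inter> {..<e j})) = real (card (P \<inter> {..<d j})) + c j - real (card (Q \<inter> {..<d j}))"
      using sum_eq[of "\<lambda>_. 1" j] by (simp add: c_def)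
    then show ?thesis
      using c[of j] by (simp add: p_def q_def add_divide_distrib diff_divide_distrib)
  qed
  have "average x P (e j) * (1 + p j - q j)
      = average x P (d j) * p j + average x Q (e j) - average x Q (d j) * q j" for j
  proof -
    have "average x P (e j) * real (card (P \<inter> {..<e j})) = average x P (d j) * real (card (P \<inter> {..<d j}))
        + average x Q (e j) * c j - average x Q (d j) * real (card (Q \<inter> {..<d j}))"
      using sum_eq[of x j] unfolding avg c_def .
    then have "average x P (e j) * (real (card (P \<inter> {..<e j})) / c j)
      = (average x P (d j) * real (card (P \<inter> {..<d j}))
        + average x Q (e j) * c j - average x Q (d j) * real (card (Q \<inter> {..<d j}))) / c j"
      by simp
    then show ?thesis
      using c[of j] unfolding card_eq by (simp add: p_def q_def add_divide_distrib diff_divide_distrib)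
  qed
  moreover have "(\<lambda>j. average x P (e j) * (1 + p j - q j)) \<longlonglongrightarrow> lP * (1 + 0 - 0)"
    by (intro tendsto_intros filterlim_compose[OF P e] p q)
  moreover have "(\<lambda>j. average x P (d j) * p j + average x Q (e j) - average x Q (d j) * q j)
      \<longlonglongrightarrow> lP * 0 + lQ - lQ * 0"
    by (intro tendsto_intros filterlim_compose[OF P d] filterlim_compose[OF Q e]
        filterlim_compose[OF Q d] p q)
  ultimately show ?thesis using LIMSEQ_unique by auto
qed

text \<open>
  The range of \<open>r\<close> has exactly \<open>n\<close> elements below \<open>r n\<close>, so each block contains many more of them than
  there are numbers before the block.
\<close>

primrec block_end :: "(nat \<Rightarrow> nat) \<Rightarrow> nat \<Rightarrow> nat" where
  "block_end r 0 = 0"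
| "block_end r (Suc k) = r (Suc k * Suc (block_end r k))"

declare block_end.simps(2) [simp del]

text \<open>The second ingredient of the splice is the whole sequence: a common limit follows once
  every subsequence is compared with it.\<close>

definition mixture :: "(nat \<Rightarrow> nat) \<Rightarrow> nat set" where
  "mixture r = {i. \<exists>k. block_end r k \<le> i \<and> i < block_end r (Suc k) \<and> (even k \<longrightarrow> i \<in> range r)}"

lemma strict_mono_block_end:
  assumes "strict_mono r"
  shows "strict_mono (block_end r)"
proof (rule strict_monoI_Suc)
  fix k
  have "block_end r k < Suc k * Suc (block_end r k)" by simp
  also have "\<dots> \<le> r (Suc k * Suc (block_end r k))"
    using assms by (rule strict_mono_imp_increasing)
  finally show "block_end r k < block_end r (Suc k)" by (simp only: block_end.simps(2))
qed

lemma mixture_block: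
  assumes "strict_mono r"
  shows "mixture r \<inter> {block_end r k..<block_end r (Suc k)}
    = (if even k then range r else UNIV) \<inter> {block_end r k..<block_end r (Suc k)}"
proof -
  have uniq: "j = k" if "block_end r j \<le> i" "i < block_end r (Suc j)"
      "block_end r k \<le> i" "i < block_end r (Suc k)" for i j
  proof -
    have "block_end r j < block_end r (Suc k)" "block_end r k < block_end r (Suc j)"
      using that by linarith+
    then have "j < Suc k" "k < Suc j"
      unfolding strict_mono_less[OF strict_mono_block_end[OF assms]] .
    then show ?thesis by linarith
  qed
  have "i \<in> mixture r \<longleftrightarrow> (even k \<longrightarrow> i \<in> range r)"
    if "block_end r k \<le> i" "i < block_end r (Suc k)" for i
    unfolding mixture_def mem_Collect_eq using uniq[OF _ _ that] that by metis
  then show ?thesis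
    by auto
qed

lemma infinite_mixture:
  assumes "strict_mono r"
  shows "infinite (mixture r)"
  unfolding infinite_nat_iff_unbounded
proof
  fix m
  define k where "k = Suc (2 * m)"
  have "block_end r k \<in> mixture r \<inter> {block_end r k..<block_end r (Suc k)}"
    unfolding mixture_block[OF assms]
    using strict_monoD[OF strict_mono_block_end[OF assms], of k "Suc k"]
    by (simp add: k_def)
  then have "block_end r k \<in> mixture r" by blast
  moreover have "m < block_end r k"
    using strict_mono_imp_increasing[OF strict_mono_block_end[OF assms], of k] by (simp add: k_def)
  ultimately show "\<exists>n>m. n \<in> mixture r" by blast
qed

lemma mixture_limits_agree:
  fixes x :: "nat \<Rightarrow> real"
  assumes r: "strict_mono r"
    and P: "average x (mixture r) \<longlonglongrightarrow> lP" and S: "average x (range r) \<longlonglongrightarrow> lS"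
    and U: "average x UNIV \<longlonglongrightarrow> lU"
  shows "lS = lU"
proof -
  let ?d = "block_end r"
  have mono: "strict_mono ?d" by (rule strict_mono_block_end[OF r])
  have card_S: "card (range r \<inter> {..<?d (Suc k)}) = Suc k * Suc (?d k)" for k
    by (simp add: card_initial_segment[OF r] block_end.simps(2) del: mult_Suc mult_Suc_right)
  \<comment> \<open>\<open>h\<close> lists blocks on which the splice agrees with \<open>Q\<close>:
    even ones for \<open>range r\<close>, odd ones for \<open>UNIV\<close>. As
    \<open>range r\<close> lies in \<open>Q\<close>, its count is a lower bound for that of
    \<open>Q\<close> in both cases.\<close>
  have key: "lP = lQ"
    if h: "strict_mono h" and Q: "average x Q \<longlonglongrightarrow> lQ" "range r \<subseteq> Q"
      "\<And>j. Q = (if even (h j) then range r else UNIV)" for h :: "nat \<Rightarrow> nat" and Q lQ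
  proof (rule block_limit_unique[where d = "\<lambda>j. ?d (h j)" and e = "\<lambda>j. ?d (Suc (h j))"])
    have card_Q: "Suc (h j) * Suc (?d (h j)) \<le> card (Q \<inter> {..<?d (Suc (h j))})" for j
      unfolding card_S[symmetric] using Q(2) by (intro card_mono) auto
    show "mixture r \<inter> {?d (h j)..<?d (Suc (h j))} = Q \<inter> {?d (h j)..<?d (Suc (h j))}" for j
      using mixture_block[OF r, of "h j"] Q(3)[of j] by simp
    show "?d (h j) \<le> ?d (Suc (h j))" for j
      using mono by (simp add: strict_mono_less_eq)
    show pos: "0 < card (Q \<inter> {..<?d (Suc (h j))})" for j
      using card_Q[of j] by simp
    show "filterlim (\<lambda>j. ?d (h j)) at_top sequentially"
      using filterlim_compose[OF filterlim_subseq[OF mono] filterlim_subseq[OF h]] .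
    have "strict_mono (\<lambda>j. Suc (h j))" using h by (simp add: strict_mono_def)
    then show "filterlim (\<lambda>j. ?d (Suc (h j))) at_top sequentially"
      by (rule filterlim_compose[OF filterlim_subseq[OF mono] filterlim_subseq])
    show "(\<lambda>j. real (?d (h j)) / real (card (Q \<inter> {..<?d (Suc (h j))}))) \<longlonglongrightarrow> 0"
    proof (rule tendsto_sandwich[OF _ _ tendsto_const])
      show "(\<lambda>j. 1 / real (Suc j)) \<longlonglongrightarrow> 0" by (rule LIMSEQ_Suc[OF lim_1_over_n])
      show "\<forall>\<^sub>F j in sequentially. real (?d (h j)) / real (card (Q \<inter> {..<?d (Suc (h j))}))
          \<le> 1 / real (Suc j)"
      proof (intro always_eventually allI)
        fix j
        have "Suc j * ?d (h j) \<le> Suc (h j) * Suc (?d (h j))"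
          using strict_mono_imp_increasing[OF h, of j] by (intro mult_le_mono) auto
        also note card_Q[of j]
        finally have "real (Suc j) * real (?d (h j)) \<le> real (card (Q \<inter> {..<?d (Suc (h j))}))"
          by (metis of_nat_le_iff of_nat_mult)
        then show "real (?d (h j)) / real (card (Q \<inter> {..<?d (Suc (h j))})) \<le> 1 / real (Suc j)"
          using pos[of j] by (simp add: divide_simps mult.commute del: of_nat_Suc)
      qed
    qed simp
  qed (fact P Q(1))+
  have "lP = lS"
    by (rule key[of "\<lambda>j. 2 * j" "range r"]) (use S in \<open>auto simp: strict_mono_def\<close>)
  moreover have "lP = lU"
    by (rule key[of "\<lambda>j. Suc (2 * j)" UNIV]) (use U in \<open>auto simp: strict_mono_def\<close>)
  ultimately show ?thesis by simp
qed

section \<open>Order convergence in terms of finitely many terms at a time\<close>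

text \<open>Divergence means that for some \<open>k\<close> every tail oscillates by more than
  \<open>1 / real (Suc k)\<close>. Finiteness of the measure turns nullity of this event into small
  measure for some tail, and finite windows exhaust each tail. The innermost condition then involves
  only indices up to \<open>m\<close>.\<close>

lemma AE_convergent_iff:
  fixes F :: "nat \<Rightarrow> 'a \<Rightarrow> real"
  assumes "finite_measure M" and F [measurable]: "\<And>n. F n \<in> borel_measurable M"
  shows "(AE t in M. convergent (\<lambda>n. F n t)) \<longleftrightarrow>
    (\<forall>k::nat. \<forall>e::nat. \<exists>n::nat. \<forall>m. measure M {t \<in> space M.
        \<exists>i\<le>m. \<exists>j\<le>m. n \<le> i \<and> n \<le> j \<and> 1 / real (Suc k) < \<bar>F i t - F j t\<bar>} \<le> 1 / real (Suc e))"
proof -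
  interpret finite_measure M by fact
  define B where "B k n m = {t \<in> space M.
    \<exists>i\<le>m. \<exists>j\<le>m. n \<le> i \<and> n \<le> j \<and> 1 / real (Suc k) < \<bar>F i t - F j t\<bar>}" for k n m :: nat
  have B [measurable]: "B k n m \<in> sets M" for k n m
    unfolding B_def by measurable
  define C where "C k n = (\<Union>m. B k n m)" for k n
  have C [measurable]: "C k n \<in> sets M" for k n
    unfolding C_def by measurable
  have C_iff: "t \<in> C k n \<longleftrightarrow> t \<in> space M \<and> (\<exists>i\<ge>n. \<exists>j\<ge>n. 1 / real (Suc k) < \<bar>F i t - F j t\<bar>)" for t k n
    unfolding C_def B_def by (auto, meson max.cobounded1 max.cobounded2)
  have "(\<lambda>m. measure M (B k n m)) \<longlonglongrightarrow> measure M (C k n)" for k n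
    unfolding C_def
    by (rule finite_Lim_measure_incseq) (auto simp: incseq_def B_def, meson order_trans)
  moreover have "measure M (B k n m) \<le> measure M (C k n)" for k n m
    by (rule finite_measure_mono) (auto simp: C_def)
  \<comment> \<open>The bound is non-strict so that it survives the limit over increasing
    windows.\<close>
  ultimately have meas_C: "(\<forall>m. measure M (B k n m) \<le> a) \<longleftrightarrow> measure M (C k n) \<le> a" for k n a
    by (meson LIMSEQ_le_const2 order_trans)
  have decr: "(\<lambda>n. measure M (C k n)) \<longlonglongrightarrow> measure M (\<Inter>n. C k n)" for k
    by (rule finite_Lim_measure_decseq) (auto simp: decseq_def C_iff, meson order_trans)
  have *: "measure M (\<Inter>n. C k n) \<le> measure M (C k n)" for k n
    by (rule finite_measure_mono) auto
  have lim0: "(\<forall>e::nat. \<exists>n. measure M (C k n) \<le> 1 / real (Suc e)) \<longleftrightarrow> measure M (\<Inter>n. C k n) = 0" for k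
  proof
    assume "\<forall>e::nat. \<exists>n. measure M (C k n) \<le> 1 / real (Suc e)"
    then have "measure M (\<Inter>n. C k n) \<le> 1 / real (Suc e)" for e
      using *[of k] order_trans by blast
    then have "measure M (\<Inter>n. C k n) \<le> 0"
      using LIMSEQ_Suc[OF lim_1_over_n] by (intro LIMSEQ_le_const) auto
    then show "measure M (\<Inter>n. C k n) = 0"
      using measure_nonneg[of M "\<Inter>n. C k n"] by linarith
  next
    assume 0: "measure M (\<Inter>n. C k n) = 0"
    show "\<forall>e::nat. \<exists>n. measure M (C k n) \<le> 1 / real (Suc e)"
    proof
      fix e :: nat
      have "eventually (\<lambda>n. measure M (C k n) < 1 / real (Suc e)) sequentially"
        using decr[of k] by (rule order_tendstoD) (simp add: 0)
      then show "\<exists>n. measure M (C k n) \<le> 1 / real (Suc e)"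
        by (meson eventually_sequentially less_imp_le order_refl)
    qed
  qed
  have "convergent (\<lambda>n. F n t) \<longleftrightarrow> (\<forall>k. t \<notin> (\<Inter>n. C k n))" if "t \<in> space M" for t
    unfolding Cauchy_convergent_iff[symmetric]
  proof
    assume "Cauchy (\<lambda>n. F n t)"
    show "\<forall>k. t \<notin> (\<Inter>n. C k n)"
    proof
      fix k
      obtain n where "\<forall>i\<ge>n. \<forall>j\<ge>n. dist (F i t) (F j t) < 1 / real (Suc k)"
        using \<open>Cauchy _\<close> unfolding Cauchy_def by (meson of_nat_0_less_iff zero_less_Suc zero_less_divide_1_iff)
      then have "t \<notin> C k n"
        unfolding C_iff dist_real_def by (meson less_asym)
      then show "t \<notin> (\<Inter>n. C k n)" by blast
    qed
  next
    assume *: "\<forall>k. t \<notin> (\<Inter>n. C k n)"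
    show "Cauchy (\<lambda>n. F n t)"
      unfolding Cauchy_def
    proof (intro allI impI)
      fix e :: real assume "0 < e"
      then obtain k where k: "1 / real (Suc k) < e"
        using nat_approx_posE by blast
      obtain n where "t \<notin> C k n" using * by blast
      then have "\<forall>i\<ge>n. \<forall>j\<ge>n. dist (F i t) (F j t) < e"
        using that k unfolding C_iff dist_real_def by (meson le_less_trans not_le)
      then show "\<exists>n. \<forall>i\<ge>n. \<forall>j\<ge>n. dist (F i t) (F j t) < e" by blast
    qed
  qed
  then have "(AE t in M. convergent (\<lambda>n. F n t)) \<longleftrightarrow> (AE t in M. \<forall>k. t \<notin> (\<Inter>n. C k n))"
    by (intro AE_cong) simp
  also have "\<dots> \<longleftrightarrow> (\<forall>k. AE t in M. t \<notin> (\<Inter>n. C k n))"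
    by (rule AE_all_countable)
  also have "\<dots> \<longleftrightarrow> (\<forall>k. measure M (\<Inter>n. C k n) = 0)"
  proof -
    have "measure M (\<Inter>n. C k n) = 0 \<longleftrightarrow> (\<Inter>n. C k n) \<in> null_sets M" for k
      by (auto simp: null_sets_def emeasure_eq_measure)
    then show ?thesis by (simp add: AE_iff_null_sets)
  qed
  finally show ?thesis
    by (simp add: lim0[symmetric] meas_C[symmetric] B_def)
qed

section \<open>Running maxima and their supremum\<close>

definition running_max :: "(nat \<Rightarrow> real \<Rightarrow> real) \<Rightarrow> nat \<Rightarrow> real \<Rightarrow> real" where
  "running_max F m t = (MAX i\<in>{..m}. \<bar>F i t\<bar>)"

text \<open>The pointwise supremum of all \<open>\<bar>F i t\<bar>\<close>, taken as a limit so that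
  measurability is immediate; the value is meaningless where the sequence is unbounded.\<close>

definition envelope :: "(nat \<Rightarrow> real \<Rightarrow> real) \<Rightarrow> real \<Rightarrow> real" where
  "envelope F t = lim (\<lambda>m. running_max F m t)"

lemma running_max_le_iff: "running_max F m t \<le> c \<longleftrightarrow> (\<forall>i\<le>m. \<bar>F i t\<bar> \<le> c)"
  by (auto simp: running_max_def)

lemma abs_le_running_max: "i \<le> m \<Longrightarrow> \<bar>F i t\<bar> \<le> running_max F m t"
  using running_max_le_iff by blast

lemma running_max_nonneg: "0 \<le> running_max F m t"
  using abs_le_running_max[of 0 m F t] by linarith

lemma running_max_mono: "m \<le> n \<Longrightarrow> running_max F m t \<le> running_max F n t"
  by (auto simp: running_max_le_iff abs_le_running_max)

lemma running_max_cong: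
  "(\<And>i. i \<le> m \<Longrightarrow> F i = G i) \<Longrightarrow> running_max F m = running_max G m"
  by (auto simp: running_max_def fun_eq_iff)

lemma running_max_measurable [measurable]:
  assumes [measurable]: "\<And>i. F i \<in> borel_measurable M"
  shows "running_max F m \<in> borel_measurable M"
  unfolding running_max_def[abs_def] by measurable

lemma envelope_measurable [measurable]:
  assumes [measurable]: "\<And>i. F i \<in> borel_measurable M"
  shows "envelope F \<in> borel_measurable M"
  unfolding envelope_def[abs_def] by measurable

lemma envelope:
  assumes "\<And>i. \<bar>F i t\<bar> \<le> c"
  shows "(\<lambda>m. running_max F m t) \<longlonglongrightarrow> envelope F t" "running_max F m t \<le> envelope F t"
    "envelope F t \<le> c" "\<bar>F i t\<bar> \<le> envelope F t"
proof -
  have inc: "incseq (\<lambda>m. running_max F m t)"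
    by (auto simp: incseq_def running_max_mono)
  have le: "running_max F m t \<le> c" for m
    using assms by (simp add: running_max_le_iff)
  obtain l where "(\<lambda>m. running_max F m t) \<longlonglongrightarrow> l"
    using incseq_convergent[OF inc] le by blast
  then show lim: "(\<lambda>m. running_max F m t) \<longlonglongrightarrow> envelope F t"
    unfolding envelope_def by (simp add: limI)
  show le_env: "running_max F m t \<le> envelope F t" for m
    using inc lim by (rule incseq_le)
  show "envelope F t \<le> c"
    using lim le by (intro LIMSEQ_le_const2) auto
  show "\<bar>F i t\<bar> \<le> envelope F t"
    using abs_le_running_max[of i i F t] le_env[of i] by linarith
qed

definition order_bounded :: "(real \<Rightarrow> real) set \<Rightarrow> (nat \<Rightarrow> real \<Rightarrow> real) \<Rightarrow> bool" where
  "order_bounded X F \<longleftrightarrow> (\<exists>h\<in>X. \<forall>n. AE t in I01. \<bar>F n t\<bar> \<le> h t)"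

lemma AE_decseq:
  fixes g :: "nat \<Rightarrow> 'a \<Rightarrow> real"
  assumes "\<And>n. AE t in M. g (Suc n) t \<le> g n t"
  shows "AE t in M. decseq (\<lambda>n. g n t)"
proof -
  have "AE t in M. \<forall>n. g (Suc n) t \<le> g n t"
    using assms by (simp add: AE_all_countable)
  then show ?thesis by eventually_elim (rule decseq_SucI, blast)
qed

section \<open>Order convergence and order boundedness in \<open>X\<close>\<close>

context banach_function_space
begin

lemma measurable_mem [measurable_dest]: "f \<in> X \<Longrightarrow> f \<in> borel_measurable I01"
  using subset_L0 by blast

lemma ideal_mem: "\<lbrakk>f \<in> L0; g \<in> X; AE t in I01. \<bar>f t\<bar> \<le> \<bar>g t\<bar>\<rbrakk> \<Longrightarrow> f \<in> X"
  using ideal by blast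

lemma norm_mono: "\<lbrakk>f \<in> X; g \<in> X; AE t in I01. \<bar>f t\<bar> \<le> \<bar>g t\<bar>\<rbrakk> \<Longrightarrow> N f \<le> N g"
  using ideal subset_L0 by blast

lemma diff_mem: "f \<in> X \<Longrightarrow> g \<in> X \<Longrightarrow> (\<lambda>t. f t - g t) \<in> X"
  using add_mem[of f "\<lambda>t. (-1) * g t"] scale_mem[of g "-1"] by simp

lemma abs_mem: "f \<in> X \<Longrightarrow> (\<lambda>t. \<bar>f t\<bar>) \<in> X"
  by (rule ideal_mem[of _ f]) (auto dest: measurable_mem)

lemma sum_mem: "(\<And>i. f i \<in> X) \<Longrightarrow> (\<lambda>t. \<Sum>i\<in>A. f i t) \<in> X"
  by (induction A rule: infinite_finite_induct) (simp_all add: zero_mem add_mem)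

lemma cesaro_mem: "(\<And>i. f i \<in> X) \<Longrightarrow> cesaro f m \<in> X"
  unfolding cesaro_def by (intro scale_mem sum_mem)

lemma running_max_mem:
  assumes "\<And>i. F i \<in> X"
  shows "running_max F m \<in> X"
proof (rule ideal_mem)
  show "running_max F m \<in> L0" using assms by measurable
  show "(\<lambda>t. \<Sum>i\<le>m. \<bar>F i t\<bar>) \<in> X" by (intro sum_mem abs_mem assms)
  have "running_max F m t \<le> (\<Sum>i\<le>m. \<bar>F i t\<bar>)" for t
    unfolding running_max_le_iff by (auto intro: member_le_sum)
  then show "AE t in I01. \<bar>running_max F m t\<bar> \<le> \<bar>\<Sum>i\<le>m. \<bar>F i t\<bar>\<bar>"
    using running_max_nonneg by (simp add: sum_nonneg)
qed

text \<open>The pointwise limit is itself a measurable lower bound, so a lattice infimum of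
  \<open>0\<close> forces it to vanish.\<close>

lemma decreases_to_zero_tendsto:
  assumes g: "\<And>n. g n \<in> L0" and dz: "decreases_to_zero g"
  shows "AE t in I01. (\<lambda>n. g n t) \<longlonglongrightarrow> 0"
proof -
  define k where "k t = lim (\<lambda>n. g n t)" for t
  have k: "k \<in> L0" unfolding k_def[abs_def] using g by measurable
  have dec: "AE t in I01. decseq (\<lambda>n. g n t)"
    by (rule AE_decseq) (use dz in \<open>simp add: decreases_to_zero_def\<close>)
  have pos: "AE t in I01. \<forall>n. 0 \<le> g n t"
    using dz by (simp add: decreases_to_zero_def AE_all_countable)
  have lim: "AE t in I01. (\<lambda>n. g n t) \<longlonglongrightarrow> k t \<and> 0 \<le> k t \<and> (\<forall>n. k t \<le> g n t)"
    using dec pos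
  proof eventually_elim
    case (elim t)
    obtain l where l: "(\<lambda>n. g n t) \<longlonglongrightarrow> l"
      using decseq_convergent[OF elim(1)] elim(2) by blast
    then have "k t = l" by (simp add: k_def limI)
    then show ?case
      using l elim decseq_ge[OF elim(1) l] LIMSEQ_le_const[OF l] by auto
  qed
  then have "\<forall>n. AE t in I01. k t \<le> g n t"
    unfolding AE_all_countable[symmetric] by eventually_elim blast
  then have "AE t in I01. k t \<le> 0"
    using dz k by (simp add: decreases_to_zero_def)
  with lim show ?thesis
    by eventually_elim (metis order_antisym)
qed

lemma order_converges_iff:
  assumes F: "\<And>n. F n \<in> X"
  shows "order_converges X F l \<longleftrightarrow>
    l \<in> X \<and> order_bounded X F \<and> (AE t in I01. (\<lambda>n. F n t) \<longlonglongrightarrow> l t)"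
proof
  assume "order_converges X F l"
  then obtain g where l: "l \<in> X" and g: "\<And>n. g n \<in> X" "decreases_to_zero g"
      "\<forall>n. AE t in I01. \<bar>F n t - l t\<bar> \<le> g n t"
    unfolding order_converges_def by blast
  have le: "AE t in I01. \<forall>n. \<bar>F n t - l t\<bar> \<le> g n t"
    using g(3) by (simp add: AE_all_countable)
  have lim: "AE t in I01. (\<lambda>n. g n t) \<longlonglongrightarrow> 0"
    using decreases_to_zero_tendsto[OF _ g(2)] g(1) by (simp add: measurable_mem)
  have conv: "AE t in I01. (\<lambda>n. F n t) \<longlonglongrightarrow> l t"
    using le lim
  proof eventually_elim
    case (elim t)
    have "(\<lambda>n. F n t - l t) \<longlonglongrightarrow> 0"
      by (rule Lim_null_comparison[OF _ elim(2)]) (use elim(1) in auto)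
    then show ?case by (simp add: LIM_zero_iff)
  qed
  have dec: "AE t in I01. decseq (\<lambda>n. g n t)"
    by (rule AE_decseq) (use g(2) in \<open>simp add: decreases_to_zero_def\<close>)
  have "AE t in I01. \<forall>n. \<bar>F n t\<bar> \<le> g 0 t + \<bar>l t\<bar>"
    using le dec
  proof eventually_elim
    case (elim t)
    show ?case
    proof
      fix n
      have "\<bar>F n t - l t\<bar> \<le> g n t" "g n t \<le> g 0 t"
        using elim by (auto simp: decseq_def)
      then show "\<bar>F n t\<bar> \<le> g 0 t + \<bar>l t\<bar>" by linarith
    qed
  qed
  moreover have "(\<lambda>t. g 0 t + \<bar>l t\<bar>) \<in> X"
    using l g(1) by (intro add_mem abs_mem)
  ultimately have "order_bounded X F"
    unfolding order_bounded_def AE_all_countable by (rule bexI[of _ "\<lambda>t. g 0 t + \<bar>l t\<bar>"])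
  with l conv show "l \<in> X \<and> order_bounded X F \<and> (AE t in I01. (\<lambda>n. F n t) \<longlonglongrightarrow> l t)"
    by blast
next
  assume "l \<in> X \<and> order_bounded X F \<and> (AE t in I01. (\<lambda>n. F n t) \<longlonglongrightarrow> l t)"
  then obtain h where l: "l \<in> X" and h: "h \<in> X" "\<forall>n. AE t in I01. \<bar>F n t\<bar> \<le> h t"
    and conv: "AE t in I01. (\<lambda>n. F n t) \<longlonglongrightarrow> l t"
    unfolding order_bounded_def by blast
  have h': "AE t in I01. \<forall>n. \<bar>F n t\<bar> \<le> h t"
    using h(2) by (simp add: AE_all_countable)
  \<comment> \<open>\<open>g n\<close> becomes the supremum of
    \<open>\<bar>F i t - l t\<bar>\<close> over \<open>i \<ge> n\<close>, the least decreasing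
    choice. It stays below \<open>h t + \<bar>l t\<bar>\<close> and hence belongs to
    \<open>X\<close>.\<close>
  define D where "D n i t = F (n + i) t - l t" for n i t
  define g where "g n = envelope (D n)" for n
  have D: "D n i \<in> X" for n i
    unfolding D_def[abs_def] by (intro diff_mem F l)
  have D_le: "\<bar>D n i t\<bar> \<le> h t + \<bar>l t\<bar>" if "\<forall>n. \<bar>F n t\<bar> \<le> h t" for n i t
    using that[rule_format, of "n + i"] unfolding D_def by linarith
  have g_L0: "g n \<in> L0" for n
    unfolding g_def by (rule envelope_measurable) (rule measurable_mem[OF D])
  have g_nonneg: "0 \<le> g n t" if "\<forall>n. \<bar>F n t\<bar> \<le> h t" for n t
    using envelope(4)[of "D n" t _ 0, OF D_le[OF that]] unfolding g_def by linarith
  have g_le: "g n t \<le> h t + \<bar>l t\<bar>" if "\<forall>n. \<bar>F n t\<bar> \<le> h t" for n t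
    unfolding g_def by (rule envelope(3)) (rule D_le[OF that])
  have g_X: "g n \<in> X" for n
  proof (rule ideal_mem[OF g_L0])
    show "(\<lambda>t. h t + \<bar>l t\<bar>) \<in> X" using h l by (intro add_mem abs_mem)
    show "AE t in I01. \<bar>g n t\<bar> \<le> \<bar>h t + \<bar>l t\<bar>\<bar>"
      using h'
    proof eventually_elim
      case (elim t)
      then show ?case using g_nonneg[OF elim, of n] g_le[OF elim, of n] by linarith
    qed
  qed
  have "decreases_to_zero g"
    unfolding decreases_to_zero_def
  proof (intro conjI allI ballI impI)
    fix n
    show "AE t in I01. 0 \<le> g n t"
      using h' by eventually_elim (rule g_nonneg)
    show "AE t in I01. g (Suc n) t \<le> g n t"
      using h'
    proof eventually_elim
      case (elim t)
      have "\<bar>D (Suc n) i t\<bar> \<le> g n t" for i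
        using envelope(4)[of "D n" t _ "Suc i", OF D_le[OF elim]] by (simp add: D_def g_def)
      then show ?case unfolding g_def by (rule envelope(3))
    qed
  next
    fix k assume "\<forall>n. AE t in I01. k t \<le> g n t"
    then have "AE t in I01. \<forall>n. k t \<le> g n t" by (simp add: AE_all_countable)
    then show "AE t in I01. k t \<le> 0"
      using h' conv
    proof eventually_elim
      case (elim t)
      show ?case
      proof (rule field_le_epsilon)
        fix e :: real assume "0 < e"
        then obtain n where n: "\<And>i. i \<ge> n \<Longrightarrow> \<bar>F i t - l t\<bar> < e"
          using elim(3) unfolding LIMSEQ_def dist_real_def by blast
        then have "\<bar>D n i t\<bar> \<le> e" for i
          unfolding D_def by (meson le_add1 less_imp_le)
        then have "g n t \<le> e" unfolding g_def by (rule envelope(3))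
        then show "k t \<le> 0 + e" using elim(1)[rule_format, of n] by linarith
      qed
    qed
  qed
  moreover have "AE t in I01. \<bar>F n t - l t\<bar> \<le> g n t" for n
    using h'
  proof eventually_elim
    case (elim t)
    show ?case
      using envelope(4)[of "D n" t _ 0, OF D_le[OF elim]] by (simp add: D_def g_def)
  qed
  ultimately show "order_converges X F l"
    unfolding order_converges_def using F l g_X by blast
qed

text \<open>Eliminates the quantifier over limits: the pointwise limit is dominated by any bound of
  the sequence, so the ideal property puts it into \<open>X\<close>.\<close>

lemma ex_order_converges_iff:
  assumes F: "\<And>n. F n \<in> X"
  shows "(\<exists>l. order_converges X F l) \<longleftrightarrow>
    order_bounded X F \<and> (AE t in I01. convergent (\<lambda>n. F n t))"
proof
  assume "\<exists>l. order_converges X F l"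
  then obtain l where "order_bounded X F" and lim: "AE t in I01. (\<lambda>n. F n t) \<longlonglongrightarrow> l t"
    using order_converges_iff[of F, OF F] by blast
  moreover have "AE t in I01. convergent (\<lambda>n. F n t)"
    using lim by eventually_elim (auto simp: convergent_def)
  ultimately show "order_bounded X F \<and> (AE t in I01. convergent (\<lambda>n. F n t))" by blast
next
  assume *: "order_bounded X F \<and> (AE t in I01. convergent (\<lambda>n. F n t))"
  then obtain h where h: "h \<in> X" "\<forall>n. AE t in I01. \<bar>F n t\<bar> \<le> h t"
    unfolding order_bounded_def by blast
  define l where "l t = lim (\<lambda>n. F n t)" for t
  have lim: "AE t in I01. (\<lambda>n. F n t) \<longlonglongrightarrow> l t"
    using conjunct2[OF *] unfolding l_def by eventually_elim (simp add: convergent_LIMSEQ_iff)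
  have "l \<in> X"
  proof (rule ideal_mem)
    show "l \<in> L0"
      unfolding l_def[abs_def] using F by (intro borel_measurable_lim_metric measurable_mem)
    show "h \<in> X" by (fact h(1))
    have "AE t in I01. \<forall>n. \<bar>F n t\<bar> \<le> h t" using h(2) by (simp add: AE_all_countable)
    then show "AE t in I01. \<bar>l t\<bar> \<le> \<bar>h t\<bar>"
      using lim
    proof eventually_elim
      case (elim t)
      have "\<bar>l t\<bar> \<le> h t"
        using tendsto_rabs[OF elim(2)] elim(1) by (intro LIMSEQ_le_const2) auto
      then show ?case by linarith
    qed
  qed
  then show "\<exists>l. order_converges X F l"
    using order_converges_iff[of F, OF F] lim * by blast
qed

lemma order_bounded_envelope:
  assumes F: "\<And>n. F n \<in> X" and bdd: "order_bounded X F"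
  shows "envelope F \<in> X"
    and "AE t in I01. (\<lambda>m. running_max F m t) \<longlonglongrightarrow> envelope F t \<and> (\<forall>m. running_max F m t \<le> envelope F t)"
proof -
  obtain h where h: "h \<in> X" "\<forall>n. AE t in I01. \<bar>F n t\<bar> \<le> h t"
    using bdd unfolding order_bounded_def by blast
  have h': "AE t in I01. \<forall>n. \<bar>F n t\<bar> \<le> h t" using h(2) by (simp add: AE_all_countable)
  show "AE t in I01. (\<lambda>m. running_max F m t) \<longlonglongrightarrow> envelope F t \<and> (\<forall>m. running_max F m t \<le> envelope F t)"
    using h'
  proof eventually_elim
    case (elim t)
    show ?case using envelope(1,2)[of F t "h t"] elim by blast
  qed
  show "envelope F \<in> X"
  proof (rule ideal_mem)
    show "envelope F \<in> L0" using F by (intro envelope_measurable measurable_mem)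
    show "h \<in> X" by (fact h(1))
    show "AE t in I01. \<bar>envelope F t\<bar> \<le> \<bar>h t\<bar>"
      using h'
    proof eventually_elim
      case (elim t)
      have "envelope F t \<le> h t" "\<bar>F 0 t\<bar> \<le> envelope F t"
        using envelope(3,4)[of F t "h t"] elim by blast+
      then show ?case by linarith
    qed
  qed
qed

text \<open>The running maxima increase, so a bound on their norms places their supremum in
  \<open>X\<close>; conversely the norm of the envelope bounds theirs. \<open>C\<close> is a natural
  number to keep the quantifier countable.\<close>

lemma order_bounded_iff_monotonically_complete:
  assumes mc: "monotonically_complete X N" and F: "\<And>n. F n \<in> X"
  shows "order_bounded X F \<longleftrightarrow> (\<exists>C::nat. \<forall>m. N (running_max F m) \<le> real C)"
proof
  assume bdd: "order_bounded X F"
  note env = order_bounded_envelope[OF F bdd]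
  have "N (running_max F m) \<le> N (envelope F)" for m
  proof (rule norm_mono[OF running_max_mem[OF F] env(1)])
    show "AE t in I01. \<bar>running_max F m t\<bar> \<le> \<bar>envelope F t\<bar>"
      using env(2)
    proof eventually_elim
      case (elim t)
      then have "running_max F m t \<le> envelope F t" by blast
      then show ?case using running_max_nonneg[of F m t] by linarith
    qed
  qed
  moreover obtain C :: nat where "N (envelope F) \<le> real C" using real_arch_simple by blast
  ultimately show "\<exists>C::nat. \<forall>m. N (running_max F m) \<le> real C" by (meson order_trans)
next
  assume "\<exists>C::nat. \<forall>m. N (running_max F m) \<le> real C"
  then have "norm_bounded N (running_max F)" by (auto simp: norm_bounded_def)
  moreover have "\<forall>m. running_max F m \<in> positive_part X"
    using running_max_mem[of F, OF F] by (simp add: positive_part_def running_max_nonneg)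
  moreover have "\<forall>m. AE t in I01. running_max F m t \<le> running_max F (Suc m) t"
    by (simp add: running_max_mono)
  ultimately obtain s where s: "s \<in> X" "AE t in I01. ereal (s t) = (SUP m. ereal (running_max F m t))"
    using mc unfolding monotonically_complete_def by blast
  have "AE t in I01. \<bar>F n t\<bar> \<le> s t" for n
    using s(2)
  proof eventually_elim
    case (elim t)
    have "ereal (running_max F n t) \<le> ereal (s t)"
      unfolding elim by (rule SUP_upper) simp
    then show ?case using abs_le_running_max[of n n F t] by simp
  qed
  then show "order_bounded X F" using s(1) unfolding order_bounded_def by blast
qed

text \<open>The right side is the Cauchy condition for the running maxima, with countable
  quantifiers. Under an order bound their distance to the envelope order converges to
  \<open>0\<close>, hence in norm; conversely their norm limit dominates every
  \<open>\<bar>F n\<bar>\<close>.\<close>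

lemma order_bounded_iff_order_continuous:
  assumes oc: "order_continuous X N" and F: "\<And>n. F n \<in> X"
  shows "order_bounded X F \<longleftrightarrow> (\<forall>k::nat. \<exists>n. \<forall>m. n \<le> m \<longrightarrow>
    N (\<lambda>t. running_max F m t - running_max F n t) \<le> 1 / real (Suc k))"
proof
  assume bdd: "order_bounded X F"
  note env = order_bounded_envelope[OF F bdd]
  define G where "G n t = envelope F t - running_max F n t" for n t
  have G: "G n \<in> X" for n
    unfolding G_def[abs_def] by (intro diff_mem env(1) running_max_mem F)
  have "order_bounded X G"
    unfolding order_bounded_def
  proof (intro bexI[of _ "envelope F"] allI env(1))
    fix n
    show "AE t in I01. \<bar>G n t\<bar> \<le> envelope F t"
      using env(2)
    proof eventually_elim
      case (elim t)
      then have "running_max F n t \<le> envelope F t" by blast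
      then show ?case using running_max_nonneg[of F n t] by (simp add: G_def)
    qed
  qed
  moreover have "AE t in I01. (\<lambda>n. G n t) \<longlonglongrightarrow> 0"
    using env(2)
  proof eventually_elim
    case (elim t)
    then have "(\<lambda>n. envelope F t - running_max F n t) \<longlonglongrightarrow> envelope F t - envelope F t"
      by (intro tendsto_intros) blast
    then show ?case by (simp add: G_def)
  qed
  ultimately have "order_converges X G (\<lambda>t. 0)"
    using order_converges_iff[of G, OF G] zero_mem by simp
  then have lim: "(\<lambda>n. N (G n)) \<longlonglongrightarrow> 0"
    using oc unfolding order_continuous_def by blast
  show "\<forall>k::nat. \<exists>n. \<forall>m. n \<le> m \<longrightarrow>
      N (\<lambda>t. running_max F m t - running_max F n t) \<le> 1 / real (Suc k)"
  proof
    fix k :: nat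
    have "eventually (\<lambda>n. N (G n) < 1 / real (Suc k)) sequentially"
      using lim by (rule order_tendstoD) simp
    then obtain n where n: "N (G n) < 1 / real (Suc k)"
      by (meson eventually_sequentially order_refl)
    have "N (\<lambda>t. running_max F m t - running_max F n t) \<le> N (G n)" if "n \<le> m" for m
    proof (rule norm_mono[OF diff_mem[OF running_max_mem[OF F] running_max_mem[OF F]] G])
      show "AE t in I01. \<bar>running_max F m t - running_max F n t\<bar> \<le> \<bar>G n t\<bar>"
        using env(2)
      proof eventually_elim
        case (elim t)
        then have "running_max F m t \<le> envelope F t" by blast
        then show ?case using running_max_mono[OF that, of F t] by (simp add: G_def)
      qed
    qed
    with n show "\<exists>n. \<forall>m. n \<le> m \<longrightarrow>
        N (\<lambda>t. running_max F m t - running_max F n t) \<le> 1 / real (Suc k)"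
      by (meson less_imp_le order_trans)
  qed
next
  let ?u = "running_max F"
  assume cauchy: "\<forall>k::nat. \<exists>n. \<forall>m. n \<le> m \<longrightarrow> N (\<lambda>t. ?u m t - ?u n t) \<le> 1 / real (Suc k)"
  have u: "?u m \<in> X" for m by (rule running_max_mem[OF F])
  have "\<forall>e>0. \<exists>K. \<forall>m\<ge>K. \<forall>n\<ge>K. N (\<lambda>t. ?u m t - ?u n t) < e"
  proof (intro allI impI)
    fix e :: real assume "0 < e"
    then obtain k where k: "1 / real (Suc k) < e / 2"
      using nat_approx_posE[of "e / 2"] by auto
    obtain K where K: "\<And>m. K \<le> m \<Longrightarrow> N (\<lambda>t. ?u m t - ?u K t) \<le> 1 / real (Suc k)"
      using cauchy by blast
    have "N (\<lambda>t. ?u m t - ?u n t) < e" if "m \<ge> K" "n \<ge> K" for m n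
    proof -
      have "N (\<lambda>t. ?u m t - ?u n t) = N (\<lambda>t. (?u m t - ?u K t) + (-1) * (?u n t - ?u K t))"
        by (rule arg_cong[of _ _ N]) auto
      also have "\<dots> \<le> N (\<lambda>t. ?u m t - ?u K t) + N (\<lambda>t. (-1) * (?u n t - ?u K t))"
        by (intro triangle diff_mem scale_mem u)
      also have "\<dots> = N (\<lambda>t. ?u m t - ?u K t) + N (\<lambda>t. ?u n t - ?u K t)"
        by (subst homogeneous) (auto intro: diff_mem u)
      finally show ?thesis using K[OF that(1)] K[OF that(2)] k by linarith
    qed
    then show "\<exists>K. \<forall>m\<ge>K. \<forall>n\<ge>K. N (\<lambda>t. ?u m t - ?u n t) < e" by blast
  qed
  then obtain f where f: "f \<in> X" "(\<lambda>m. N (\<lambda>t. ?u m t - f t)) \<longlonglongrightarrow> 0"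
    using complete[of ?u] u by blast
  have "AE t in I01. \<bar>F n t\<bar> \<le> f t" for n
  proof -
    \<comment> \<open>\<open>p\<close> measures the failure of \<open>f\<close> to dominate. Since
      the running maxima increase, \<open>p\<close> lies below
      \<open>\<bar>?u m t - f t\<bar>\<close> for every \<open>m \<ge> n\<close>, and these norms
      tend to \<open>0\<close>.\<close>
    define p where "p t = max 0 (?u n t - f t)" for t
    have p: "p \<in> X"
    proof (rule ideal_mem)
      show "p \<in> L0" unfolding p_def[abs_def] using u[of n] f(1) by measurable
      show "(\<lambda>t. ?u n t - f t) \<in> X" by (intro diff_mem u f)
    qed (auto simp: p_def)
    have "N p \<le> N (\<lambda>t. ?u m t - f t)" if "n \<le> m" for m
    proof (rule norm_mono[OF p diff_mem[OF u f(1)]])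
      show "AE t in I01. \<bar>p t\<bar> \<le> \<bar>?u m t - f t\<bar>"
        using running_max_mono[OF that, of F] by (intro always_eventually allI) (smt (verit) p_def)
    qed
    then have "N p \<le> 0"
      using f(2) by (intro LIMSEQ_le_const) auto
    then have "AE t in I01. p t = 0"
      using definite[OF p] nonneg[OF p] by linarith
    then show ?thesis
    proof eventually_elim
      case (elim t)
      then show ?case using abs_le_running_max[of n n F t] by (simp add: p_def max_def split: if_splits)
    qed
  qed
  then show "order_bounded X F" using f(1) unfolding order_bounded_def by blast
qed

end

section \<open>Cesaro convergence along all subsequences\<close>

context banach_function_space
begin

lemma completely_ramsey_cesaro_convergence:
  assumes f: "\<And>n. f n \<in> X" and "order_continuous X N \<or> monotonically_complete X N"
  shows "completely_ramsey (\<lambda>L. \<exists>l. order_converges X (cesaro (f \<circ> enumerate L)) l)"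
proof -
  let ?S = "\<lambda>L. cesaro (f \<circ> enumerate L)"
  \<comment> \<open>A mean of index \<open>i\<close> reads the first \<open>i + 1\<close> elements
    of \<open>L\<close>. So whatever is formed from means of index at most \<open>m\<close> is an
    atomic condition for \<open>completely_ramsey_finite_dependence\<close>.\<close>
  have agree: "?S L i = ?S L' i"
    if "\<And>i. i \<le> m \<Longrightarrow> enumerate L i = enumerate L' i" "i \<le> m" for L L' :: "nat set" and i m
  proof -
    have "(\<Sum>n\<le>i. (f \<circ> enumerate L) n t) = (\<Sum>n\<le>i. (f \<circ> enumerate L') n t)" for t
      using that by (intro sum.cong) auto
    then show ?thesis by (simp add: cesaro_def)
  qed
  have S: "?S L i \<in> X" for L i
    by (rule cesaro_mem) (simp add: f)
  have S_L0: "?S L i \<in> L0" for L i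
    using S by (rule measurable_mem)
  have "finite_measure I01"
    by (rule finite_measure_lebesgue_on) simp
  then have conv_iff: "(AE t in I01. convergent (\<lambda>n. ?S L n t)) \<longleftrightarrow>
      (\<forall>k::nat. \<forall>e::nat. \<exists>n::nat. \<forall>m. measure I01 {t \<in> space I01.
        \<exists>i\<le>m. \<exists>j\<le>m. n \<le> i \<and> n \<le> j \<and> 1 / real (Suc k) < \<bar>?S L i t - ?S L j t\<bar>} \<le> 1 / real (Suc e))"
    for L using S_L0 by (rule AE_convergent_iff)
  have conv: "completely_ramsey (\<lambda>L. AE t in I01. convergent (\<lambda>n. ?S L n t))"
    unfolding conv_iff
  proof (intro completely_ramsey_all completely_ramsey_ex)
    fix k e n m :: nat
    let ?B = "\<lambda>L. {t \<in> space I01.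
        \<exists>i\<le>m. \<exists>j\<le>m. n \<le> i \<and> n \<le> j \<and> 1 / real (Suc k) < \<bar>?S L i t - ?S L j t\<bar>}"
    show "completely_ramsey (\<lambda>L. measure I01 (?B L) \<le> 1 / real (Suc e))"
    proof (rule completely_ramsey_finite_dependence[where m = m])
      fix L L' :: "nat set"
      assume "\<And>i. i \<le> m \<Longrightarrow> enumerate L i = enumerate L' i"
      then have "?S L i = ?S L' i" if "i \<le> m" for i using agree that by blast
      then have "?B L = ?B L'" by (simp cong: conj_cong)
      moreover assume "measure I01 (?B L) \<le> 1 / real (Suc e)"
      ultimately show "measure I01 (?B L') \<le> 1 / real (Suc e)" by simp
    qed
  qed
  have rm_agree: "running_max (?S L) i = running_max (?S L') i"
    if "\<And>i. i \<le> m \<Longrightarrow> enumerate L i = enumerate L' i" "i \<le> m" for L L' :: "nat set" and i m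
    using that by (intro running_max_cong agree) auto
  from assms(2) have bdd: "completely_ramsey (\<lambda>L. order_bounded X (?S L))"
  proof
    assume "monotonically_complete X N"
    then have iff: "order_bounded X (?S L) \<longleftrightarrow> (\<exists>C::nat. \<forall>m. N (running_max (?S L) m) \<le> real C)" for L
      using S by (rule order_bounded_iff_monotonically_complete)
    show ?thesis
      unfolding iff
    proof (intro completely_ramsey_all completely_ramsey_ex)
      fix C m :: nat
      show "completely_ramsey (\<lambda>L. N (running_max (?S L) m) \<le> real C)"
      proof (rule completely_ramsey_finite_dependence[where m = m])
        fix L L' :: "nat set"
        assume "\<And>i. i \<le> m \<Longrightarrow> enumerate L i = enumerate L' i"
        then have "running_max (?S L) m = running_max (?S L') m" using rm_agree by blast
        moreover assume "N (running_max (?S L) m) \<le> real C"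
        ultimately show "N (running_max (?S L') m) \<le> real C" by simp
      qed
    qed
  next
    assume "order_continuous X N"
    then have iff: "order_bounded X (?S L) \<longleftrightarrow> (\<forall>k::nat. \<exists>n. \<forall>m. n \<le> m \<longrightarrow>
        N (\<lambda>t. running_max (?S L) m t - running_max (?S L) n t) \<le> 1 / real (Suc k))" for L
      using S by (rule order_bounded_iff_order_continuous)
    show ?thesis
      unfolding iff
    proof (intro completely_ramsey_all completely_ramsey_ex)
      fix k n m :: nat
      let ?R = "\<lambda>L. N (\<lambda>t. running_max (?S L) m t - running_max (?S L) n t) \<le> 1 / real (Suc k)"
      \<comment> \<open>The guard stays inside the atomic condition so that \<open>m\<close> alone
        limits the elements read.\<close>
      show "completely_ramsey (\<lambda>L. n \<le> m \<longrightarrow> ?R L)"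
      proof (rule completely_ramsey_finite_dependence[where m = m])
        fix L L' :: "nat set"
        assume same: "\<And>i. i \<le> m \<Longrightarrow> enumerate L i = enumerate L' i"
          and R: "n \<le> m \<longrightarrow> ?R L"
        have "running_max (?S L) m = running_max (?S L') m"
          using rm_agree[OF same, of m] by simp
        moreover have "running_max (?S L) n = running_max (?S L') n" if "n \<le> m"
          using rm_agree[OF same that] by simp
        ultimately show "n \<le> m \<longrightarrow> ?R L'" using R by simp
      qed
    qed
  qed
  have "(\<lambda>L. \<exists>l. order_converges X (?S L) l) =
      (\<lambda>L. order_bounded X (?S L) \<and> (AE t in I01. convergent (\<lambda>n. ?S L n t)))"
    by (rule ext) (rule ex_order_converges_iff[OF S])
  then show ?thesis using completely_ramsey_conj[OF bdd conv] by simp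
qed

text \<open>The limit along the whole sequence serves for all \<open>s\<close>. Each
  \<open>s\<close> is compared with it separately, so its exceptional null set may depend on
  \<open>s\<close>, of which there are uncountably many.\<close>

lemma cesaro_common_limit:
  assumes g: "\<And>n. g n \<in> X"
    and conv: "\<And>s::nat \<Rightarrow> nat. strict_mono s \<Longrightarrow> \<exists>l. order_converges X (cesaro (g \<circ> s)) l"
  shows "\<exists>l. \<forall>s::nat \<Rightarrow> nat. strict_mono s \<longrightarrow> order_converges X (cesaro (g \<circ> s)) l"
proof -
  have iff: "order_converges X (cesaro (g \<circ> s)) l \<longleftrightarrow> l \<in> X \<and> order_bounded X (cesaro (g \<circ> s)) \<and>
      (AE t in I01. (\<lambda>n. cesaro (g \<circ> s) n t) \<longlonglongrightarrow> l t)" for s :: "nat \<Rightarrow> nat" and l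
    by (rule order_converges_iff) (simp add: cesaro_mem g)
  have avg: "average (\<lambda>i. g i t) (range s) \<longlonglongrightarrow> l"
    if "strict_mono s" "(\<lambda>n. cesaro (g \<circ> s) n t) \<longlonglongrightarrow> l" for s :: "nat \<Rightarrow> nat" and t l
    using that by (intro average_tendsto) (simp_all add: cesaro_def)
  have id: "strict_mono (id :: nat \<Rightarrow> nat)" by (simp add: strict_mono_def)
  obtain l where l: "order_converges X (cesaro (g \<circ> id)) l" using conv[OF id] by blast
  have "order_converges X (cesaro (g \<circ> s)) l" if s: "strict_mono s" for s :: "nat \<Rightarrow> nat"
  proof -
    \<comment> \<open>The splice is itself a subsequence, so its means converge a.e. by
      \<open>conv\<close>; this forces the other two limits to agree.\<close>
    define p where "p = enumerate (mixture s)"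
    have p: "strict_mono p" "range p = mixture s"
      unfolding p_def using infinite_mixture[OF s]
      by (rule strict_mono_enumerate, rule range_enumerate)
    obtain ls where ls: "order_converges X (cesaro (g \<circ> s)) ls" using conv[OF s] by blast
    obtain lp where lp: "order_converges X (cesaro (g \<circ> p)) lp" using conv[OF p(1)] by blast
    have "AE t in I01. (\<lambda>n. cesaro (g \<circ> s) n t) \<longlonglongrightarrow> ls t" using ls iff by blast
    moreover have "AE t in I01. (\<lambda>n. cesaro (g \<circ> p) n t) \<longlonglongrightarrow> lp t" using lp iff by blast
    moreover have "AE t in I01. (\<lambda>n. cesaro (g \<circ> id) n t) \<longlonglongrightarrow> l t" using l iff by blast
    ultimately have "AE t in I01. (\<lambda>n. cesaro (g \<circ> s) n t) \<longlonglongrightarrow> l t"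
    proof eventually_elim
      case (elim t)
      have "ls t = l t"
      proof (rule mixture_limits_agree[OF s])
        show "average (\<lambda>i. g i t) (mixture s) \<longlonglongrightarrow> lp t"
          using avg[OF p(1) elim(2)] p(2) by simp
        show "average (\<lambda>i. g i t) (range s) \<longlonglongrightarrow> ls t" by (rule avg[OF s elim(1)])
        show "average (\<lambda>i. g i t) UNIV \<longlonglongrightarrow> l t" using avg[OF id elim(3)] by simp
      qed
      with elim(1) show ?case by simp
    qed
    then show ?thesis using l ls unfolding iff by blast
  qed
  then show ?thesis by blast
qed

text \<open>The common core of both equivalences: \<open>sub\<close> is what either Banach-Saks
  property yields for a null sequence, since the respective class of sequences is closed under
  subsequences.\<close>

lemma hereditary_cesaro_convergence:
  assumes f: "\<And>n. f n \<in> X" and cond: "order_continuous X N \<or> monotonically_complete X N"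
    and sub: "\<And>r::nat \<Rightarrow> nat. strict_mono r \<Longrightarrow>
      \<exists>s::nat \<Rightarrow> nat. strict_mono s \<and> (\<exists>l. order_converges X (cesaro (f \<circ> r \<circ> s)) l)"
  shows "\<exists>r::nat \<Rightarrow> nat. strict_mono r \<and>
    (\<exists>l. \<forall>s::nat \<Rightarrow> nat. strict_mono s \<longrightarrow> order_converges X (cesaro (f \<circ> r \<circ> s)) l)"
proof -
  let ?R = "\<lambda>L. \<exists>l. order_converges X (cesaro (f \<circ> enumerate L)) l"
  have "completely_ramsey ?R"
    using f cond by (rule completely_ramsey_cesaro_convergence)
  then obtain B :: "nat set" where B: "infinite B" "decided ?R {} B"
    unfolding completely_ramsey_def using finite.emptyI infinite_UNIV_nat by blast
  then obtain c where c: "\<And>L. L \<subseteq> B \<Longrightarrow> infinite L \<Longrightarrow> ?R L = c"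
    unfolding decided_def by auto
  define r where "r = enumerate B"
  have r: "strict_mono r" "range r = B"
    unfolding r_def using B(1) by (rule strict_mono_enumerate, rule range_enumerate)
  \<comment> \<open>Subsequences of \<open>r\<close> correspond to infinite subsets of
    \<open>B\<close>, so they share one verdict \<open>c\<close>; a single convergent case, provided
    by \<open>sub\<close>, makes it true.\<close>
  have R_iff: "(\<exists>l. order_converges X (cesaro (f \<circ> r \<circ> s)) l) = c" if s: "strict_mono s" for s :: "nat \<Rightarrow> nat"
  proof -
    have rs: "strict_mono (r \<circ> s)"
      using r(1) s by (rule strict_mono_o)
    have "range (r \<circ> s) \<subseteq> B" using r(2) by auto
    moreover have "infinite (range (r \<circ> s))"
      using strict_mono_imp_inj_on[OF rs] by (rule range_inj_infinite)
    ultimately have "?R (range (r \<circ> s)) = c" by (rule c)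
    then show ?thesis by (simp only: enumerate_range[OF rs] comp_assoc)
  qed
  have c using sub[OF r(1)] R_iff by blast
  then have "\<exists>l. order_converges X (cesaro (f \<circ> r \<circ> s)) l" if "strict_mono s" for s :: "nat \<Rightarrow> nat"
    using R_iff[OF that] by blast
  then have "\<exists>l. \<forall>s::nat \<Rightarrow> nat. strict_mono s \<longrightarrow> order_converges X (cesaro (f \<circ> r \<circ> s)) l"
    by (intro cesaro_common_limit) (simp add: f)
  then show ?thesis using r(1) by blast
qed

end

section \<open>Null sequences under passage to subsequences, and the two equivalences\<close>

lemma weakly_null_subseq:
  "weakly_null X N f \<Longrightarrow> strict_mono r \<Longrightarrow> weakly_null X N (f \<circ> r)"
  unfolding weakly_null_def by (auto intro: filterlim_compose[OF _ filterlim_subseq])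

lemma associate_null_subseq:
  "associate_null X f \<Longrightarrow> strict_mono r \<Longrightarrow> associate_null X (f \<circ> r)"
  unfolding associate_null_def
  by (auto intro: filterlim_compose[of "\<lambda>n. LINT t|I01. f n t * g t" for g, OF _ filterlim_subseq])

lemma norm_bounded_subseq: "norm_bounded N f \<Longrightarrow> norm_bounded N (f \<circ> r)"
  by (auto simp: norm_bounded_def)

theorem theorem4p8:
  fixes X :: "(real \<Rightarrow> real) set" and N :: "(real \<Rightarrow> real) \<Rightarrow> real"
  assumes "banach_function_space X N"
    and "order_continuous X N \<or> monotonically_complete X N"
  shows "(w_oBSP X N \<longleftrightarrow> w_hoBSP X N) \<and> (associate_oBSP X N \<longleftrightarrow> associate_hoBSP X N)"
proof (intro conjI iffI)
  interpret banach_function_space X N by fact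
  show "w_hoBSP X N" if oBSP: "w_oBSP X N"
    unfolding w_hoBSP_def
  proof (intro allI impI)
    fix f assume f: "weakly_null X N f"
    show "\<exists>r::nat \<Rightarrow> nat. strict_mono r \<and>
        (\<exists>l. \<forall>s::nat \<Rightarrow> nat. strict_mono s \<longrightarrow> order_converges X (cesaro (f \<circ> r \<circ> s)) l)"
    proof (rule hereditary_cesaro_convergence[OF _ assms(2)])
      show "f n \<in> X" for n using f by (simp add: weakly_null_def)
      show "\<exists>s::nat \<Rightarrow> nat. strict_mono s \<and> (\<exists>l. order_converges X (cesaro (f \<circ> r \<circ> s)) l)"
        if "strict_mono r" for r :: "nat \<Rightarrow> nat"
        using oBSP weakly_null_subseq[OF f that] unfolding w_oBSP_def by blast
    qed
  qed
  show "associate_hoBSP X N" if oBSP: "associate_oBSP X N"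
    unfolding associate_hoBSP_def
  proof (intro allI impI)
    fix f assume f: "associate_null X f \<and> norm_bounded N f"
    show "\<exists>r::nat \<Rightarrow> nat. strict_mono r \<and>
        (\<exists>l. \<forall>s::nat \<Rightarrow> nat. strict_mono s \<longrightarrow> order_converges X (cesaro (f \<circ> r \<circ> s)) l)"
    proof (rule hereditary_cesaro_convergence[OF _ assms(2)])
      show "f n \<in> X" for n using f by (simp add: associate_null_def)
      show "\<exists>s::nat \<Rightarrow> nat. strict_mono s \<and> (\<exists>l. order_converges X (cesaro (f \<circ> r \<circ> s)) l)"
        if "strict_mono r" for r :: "nat \<Rightarrow> nat"
        using oBSP f associate_null_subseq[OF _ that] norm_bounded_subseq
        unfolding associate_oBSP_def by blast
    qed
  qed
next
  have id: "strict_mono (id :: nat \<Rightarrow> nat)" by (simp add: strict_mono_def)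
  show "w_oBSP X N" if "w_hoBSP X N"
    using that id unfolding w_hoBSP_def w_oBSP_def by (metis comp_id)
  show "associate_oBSP X N" if "associate_hoBSP X N"
    using that id unfolding associate_hoBSP_def associate_oBSP_def by (metis comp_id)
qed

end
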